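(* Let $X\in\mathbb{R}^{n\times p}$ with $\operatorname{rank}(X)=p$ and $y\in\mathbb{R}^n$. Let $\tilde u_\lambda$, $\lambda\in[0,\infty)$, be the approximate lasso dual path, i.e. the path in $\mathbb{R}^p$ produced by the dual path algorithm described in the context applied with $\tilde y=XX^+y$ and $\tilde D=X^+$ and with the leaving-time step omitted, and define the primal path $$\tilde\beta_\lambda=(X^TX)^{-1}(X^Ty-\tilde u_\lambda).$$ Then $\tilde\beta_\lambda$ is exactly the LARS path (of LARS in its original, unmodified form) for the data $(X,y)$.
   Context: $A^+$ denotes the Moore–Penrose pseudoinverse (so $X^+=(X^TX)^{-1}X^T$). For an ordered list of indices $\mathcal{B}$, $A_{\mathcal{B}}$ (resp. $x_{\mathcal{B}}$) consists of the rows of $A$ (resp. coordinates of $x$) indexed by $\mathcal{B}$, and the subscript $-\mathcal{B}$ refers to all remaining rows or coordinates. Dual path algorithm, leaving times ignored (data $\tilde y\in\mathbb{R}^n$, penalty matrix $\tilde D\in\mathbb{R}^{p\times n}$). Start with $k=0$, $\lambda_0=\infty$, boundary list $\mathcal{B}=\varnothing$, sign vector $s=\varnothing$. While $\lambda_k>0$: set $$a=(\tilde D_{-\mathcal{B}}\tilde D_{-\mathcal{B}}^T)^+\tilde D_{-\mathcal{B}}\,\tilde y,\qquad b=(\tilde D_{-\mathcal{B}}\tilde D_{-\mathcal{B}}^T)^+\tilde D_{-\mathcal{B}}\tilde D_{\mathcal{B}}^T s .$$ For each $i\notin\mathcal{B}$ the hitting time $t_i$ is the value $\lambda\in[0,\lambda_k]$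 (finite) at which $a_i-\lambda b_i=\pm\lambda$, i.e. $t_i=a_i/(b_i\pm1)$ (the largest such value, i.e. the first one reached as $\lambda$ decreases from $\lambda_k$). Let $\lambda_{k+1}=\max_{i\notin\mathcal{B}}t_i$ (taken to be $0$ if no $i\notin\mathcal{B}$ remains). For $\lambda\in[\lambda_{k+1},\lambda_k]$ put $\tilde u_{\lambda,\mathcal{B}}=\lambda s$ and $\tilde u_{\lambda,-\mathcal{B}}=a-\lambda b$. Then append the maximizing coordinate $i$ to $\mathcal{B}$ and $\operatorname{sign}(\tilde u_{\lambda_{k+1},i})$ to $s$, and increase $k$ by one. (Coordinates are never removed from $\mathcal{B}$.) LARS (original, unmodified least angle regression). Let $X_j$ be the $j$th column of $X$ and, for a coefficient vector $\beta$, let $r=y-X\beta$ be the residual; the "correlation" of variable $j$ with the residual is $X_j^Tr$. Start at $\beta=0$; the variable with the largest absolute correlation with $r=y$ enters the active set $\mathcal{A}$, with sign equal to the sign of its correlation. Coefficients of inactive variables stay $0$. The active coefficients move continuously and linearly in the direction $(X_{\mathcal{A}}^TX_{\mathcal{A}})^{-1}s_{\mathcal{A}}$ (here $X_{\mathcal{A}}$ is the submatrix of active columns and $s_{\mathcal{A}}$ the vector of their signs), so that the absolute correlations of all active variables with the residual remain equal to each other and decrease; this continues until some inactive variable's absolute correlation equals this common value, at which point that variable joins $\mathcal{A}$ with the sign of its correlation, and the procedure repeats. It ends when the common absolute correlation reaches $0$. No variable ever leaves $\mathcal{A}$. The LARS path is parametrized by the common maximal absolute correlation $\lambda$ of the active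 variables with the residual (and is $0$ for $\lambda\ge\max_j|X_j^Ty|$). If several variables reach the common value at once, ties are broken by the same rule in both procedures. *)

theory Defs
  imports
    "Jordan_Normal_Form.DL_Rank"
    "Jordan_Normal_Form.Gauss_Jordan_Elimination"
    "HOL-Library.Extended_Real"
begin

section \<open>Matrices\<close>

text \<open>The Moore--Penrose pseudoinverse, given by the four Penrose conditions.\<close>

definition is_pinv :: "real mat \<Rightarrow> real mat \<Rightarrow> bool" where
  "is_pinv A P \<longleftrightarrow>
     P \<in> carrier_mat (dim_col A) (dim_row A) \<and>
     A * P * A = A \<and> P * A * P = P \<and>
     transpose_mat (A * P) = A * P \<and> transpose_mat (P * A) = P * A"

definition pinv :: "real mat \<Rightarrow> real mat" where
  "pinv A = (THE P. is_pinv A P)"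

text \<open>The ordinary inverse; meaningful for invertible square matrices only.\<close>

definition mat_inv :: "real mat \<Rightarrow> real mat" where
  "mat_inv A = the (mat_inverse A)"

definition sub_rows :: "real mat \<Rightarrow> nat list \<Rightarrow> real mat" where
  "sub_rows A I = mat_of_rows (dim_col A) (map (row A) I)"

definition sub_cols :: "real mat \<Rightarrow> nat list \<Rightarrow> real mat" where
  "sub_cols A I = mat_of_cols (dim_row A) (map (col A) I)"

definition sub_vec :: "real vec \<Rightarrow> nat list \<Rightarrow> real vec" where
  "sub_vec v I = vec_of_list (map (\<lambda>i. v $ i) I)"

text \<open>The indices below \<open>p\<close> that are not in \<open>I\<close>, in increasing order (the subscript \<open>-I\<close>).\<close>

definition remaining :: "nat \<Rightarrow> nat list \<Rightarrow> nat list" where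
  "remaining p I = filter (\<lambda>i. i \<notin> set I) [0..<p]"


section \<open>The dual path algorithm without leaving times\<close>

text \<open>
  A tie-breaking rule is a function \<open>tie\<close> that receives the ordered list of the variables that
  have entered so far and the set of tied candidates, and returns one of these candidates.

  The vectors \<open>a\<close> and \<open>b\<close> are indexed by positions in \<open>remaining p B\<close>: their entry at
  position \<open>m\<close> belongs to the coordinate \<open>remaining p B ! m\<close>.
\<close>

definition dual_a :: "real vec \<Rightarrow> real mat \<Rightarrow> nat list \<Rightarrow> real vec" where
  "dual_a y D B =
     (let E = sub_rows D (remaining (dim_row D) B)
      in pinv (E * transpose_mat E) *\<^sub>v (E *\<^sub>v y))"

definition dual_b :: "real mat \<Rightarrow> nat list \<Rightarrow> real list \<Rightarrow> real vec" where
  "dual_b D B s =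
     (let E = sub_rows D (remaining (dim_row D) B)
      in pinv (E * transpose_mat E) *\<^sub>v
           (E *\<^sub>v (transpose_mat (sub_rows D B) *\<^sub>v vec_of_list s)))"

text \<open>
  The hitting time is stated through the equation \<open>a - t b = \<plusminus>t\<close> and not as \<open>a / (b \<plusminus> 1)\<close>,
  since the denominator may vanish.
\<close>

definition hitting_time :: "ereal \<Rightarrow> real \<Rightarrow> real \<Rightarrow> real" where
  "hitting_time L a b =
     (GREATEST t. 0 \<le> t \<and> ereal t \<le> L \<and> (a - t * b = t \<or> a - t * b = - t))"

definition dual_hit :: "real vec \<Rightarrow> real mat \<Rightarrow> ereal \<Rightarrow> nat list \<Rightarrow> real list \<Rightarrow> nat \<Rightarrow> real" where
  "dual_hit y D L B s m = hitting_time L (dual_a y D B $ m) (dual_b D B s $ m)"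

definition dual_next :: "real vec \<Rightarrow> real mat \<Rightarrow> ereal \<Rightarrow> nat list \<Rightarrow> real list \<Rightarrow> real" where
  "dual_next y D L B s =
     (let R = remaining (dim_row D) B
      in if R = [] then 0 else Max (dual_hit y D L B s ` {..<length R}))"

text \<open>
  \<open>dual_state y D tie L B s\<close>: some iteration of the algorithm starts with knot \<open>L\<close>,
  boundary list \<open>B\<close> and signs \<open>s\<close>.
\<close>

inductive dual_state ::
  "real vec \<Rightarrow> real mat \<Rightarrow> (nat list \<Rightarrow> nat set \<Rightarrow> nat) \<Rightarrow> ereal \<Rightarrow> nat list \<Rightarrow> real list \<Rightarrow> bool"
  for y D tie where
  start: "dual_state y D tie \<infinity> [] []"
| step: "dual_state y D tie L B s \<Longrightarrow> 0 < L \<Longrightarrow>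
    R = remaining (dim_row D) B \<Longrightarrow> L' = dual_next y D L B s \<Longrightarrow> m < length R \<Longrightarrow>
    R ! m = tie B {R ! l | l. l < length R \<and> dual_hit y D L B s l = L'} \<Longrightarrow>
    dual_state y D tie (ereal L') (B @ [R ! m])
      (s @ [sgn (dual_a y D B $ m - L' * dual_b D B s $ m)])"

definition on_dual_path ::
  "real vec \<Rightarrow> real mat \<Rightarrow> (nat list \<Rightarrow> nat set \<Rightarrow> nat) \<Rightarrow> real \<Rightarrow> real vec \<Rightarrow> bool" where
  "on_dual_path y D tie lam u \<longleftrightarrow>
     (\<exists>L B s. dual_state y D tie L B s \<and> 0 < L \<and>
        dual_next y D L B s \<le> lam \<and> ereal lam \<le> L \<and>
        u \<in> carrier_vec (dim_row D) \<and>
        sub_vec u B = lam \<cdot>\<^sub>v vec_of_list s \<and>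
        sub_vec u (remaining (dim_row D) B) = dual_a y D B - lam \<cdot>\<^sub>v dual_b D B s)"

definition dual_path ::
  "real vec \<Rightarrow> real mat \<Rightarrow> (nat list \<Rightarrow> nat set \<Rightarrow> nat) \<Rightarrow> real \<Rightarrow> real vec" where
  "dual_path y D tie lam = (THE u. on_dual_path y D tie lam u)"


section \<open>Least angle regression\<close>

definition correlation :: "real mat \<Rightarrow> real vec \<Rightarrow> real vec \<Rightarrow> nat \<Rightarrow> real" where
  "correlation X y \<beta> j = col X j \<bullet> (y - X *\<^sub>v \<beta>)"

text \<open>The active set is kept as the list of its elements in order of entry.\<close>

definition active_level :: "real mat \<Rightarrow> real vec \<Rightarrow> nat list \<Rightarrow> real vec \<Rightarrow> real" where
  "active_level X y A \<beta> = Max ((\<lambda>j. \<bar>correlation X y \<beta> j\<bar>) ` set A)"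

text \<open>
  The matrix whose columns are the unit vectors indexed by \<open>A\<close> puts the coordinates of the
  active direction in their places and \<open>0\<close> in all inactive ones.
\<close>

definition lars_direction :: "real mat \<Rightarrow> nat list \<Rightarrow> real list \<Rightarrow> real vec" where
  "lars_direction X A s =
     mat_of_cols (dim_col X) (map (unit_vec (dim_col X)) A) *\<^sub>v
       (mat_inv (transpose_mat (sub_cols X A) * sub_cols X A) *\<^sub>v vec_of_list s)"

definition lars_move ::
  "real mat \<Rightarrow> nat list \<Rightarrow> real list \<Rightarrow> real vec \<Rightarrow> real \<Rightarrow> real vec" where
  "lars_move X A s \<beta> \<gamma> = \<beta> + \<gamma> \<cdot>\<^sub>v lars_direction X A s"

definition tied_inactive :: "real mat \<Rightarrow> real vec \<Rightarrow> nat list \<Rightarrow> real vec \<Rightarrow> nat set" where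
  "tied_inactive X y A \<beta> =
     {j. j < dim_col X \<and> j \<notin> set A \<and> \<bar>correlation X y \<beta> j\<bar> = active_level X y A \<beta>}"

definition lars_step :: "real mat \<Rightarrow> real vec \<Rightarrow> nat list \<Rightarrow> real list \<Rightarrow> real vec \<Rightarrow> real" where
  "lars_step X y A s \<beta> =
     (LEAST \<gamma>. 0 \<le> \<gamma> \<and>
        (tied_inactive X y A (lars_move X A s \<beta> \<gamma>) \<noteq> {} \<or>
         active_level X y A (lars_move X A s \<beta> \<gamma>) = 0))"

text \<open>
  \<open>lars_state X y tie A s \<beta>\<close>: some stage of LARS starts at the coefficients \<open>\<beta>\<close> with
  active variables \<open>A\<close> and signs \<open>s\<close>.
\<close>

inductive lars_state ::
  "real mat \<Rightarrow> real vec \<Rightarrow> (nat list \<Rightarrow> nat set \<Rightarrow> nat) \<Rightarrow>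
   nat list \<Rightarrow> real list \<Rightarrow> real vec \<Rightarrow> bool"
  for X y tie where
  start: "0 < dim_col X \<Longrightarrow> \<beta> = 0\<^sub>v (dim_col X) \<Longrightarrow>
    j = tie [] {j. j < dim_col X \<and>
      (\<forall>i < dim_col X. \<bar>correlation X y \<beta> i\<bar> \<le> \<bar>correlation X y \<beta> j\<bar>)} \<Longrightarrow>
    lars_state X y tie [j] [sgn (correlation X y \<beta> j)] \<beta>"
| step: "lars_state X y tie A s \<beta> \<Longrightarrow>
    \<beta>' = lars_move X A s \<beta> (lars_step X y A s \<beta>) \<Longrightarrow> 0 < active_level X y A \<beta>' \<Longrightarrow>
    j = tie A (tied_inactive X y A \<beta>') \<Longrightarrow>
    lars_state X y tie (A @ [j]) (s @ [sgn (correlation X y \<beta>' j)]) \<beta>'"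

definition on_lars_path ::
  "real mat \<Rightarrow> real vec \<Rightarrow> (nat list \<Rightarrow> nat set \<Rightarrow> nat) \<Rightarrow> real \<Rightarrow> real vec \<Rightarrow> bool" where
  "on_lars_path X y tie lam \<beta> \<longleftrightarrow>
     (\<beta> = 0\<^sub>v (dim_col X) \<and> (\<forall>j < dim_col X. \<bar>col X j \<bullet> y\<bar> \<le> lam)) \<or>
     (\<exists>A s \<beta>0 \<gamma>. lars_state X y tie A s \<beta>0 \<and> 0 \<le> \<gamma> \<and> \<gamma> \<le> lars_step X y A s \<beta>0 \<and>
        \<beta> = lars_move X A s \<beta>0 \<gamma> \<and> lam = active_level X y A \<beta>)"

text \<open>
  \<open>f\<close> is the LARS path: for every \<open>lam \<ge> 0\<close>, \<open>f lam\<close> is the one and only point that LARS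
  visits at level \<open>lam\<close>.
\<close>

definition is_lars_path ::
  "real mat \<Rightarrow> real vec \<Rightarrow> (nat list \<Rightarrow> nat set \<Rightarrow> nat) \<Rightarrow> (real \<Rightarrow> real vec) \<Rightarrow> bool" where
  "is_lars_path X y tie f \<longleftrightarrow>
     (\<forall>lam \<ge> 0. \<forall>\<beta>. on_lars_path X y tie lam \<beta> \<longleftrightarrow> \<beta> = f lam)"


section \<open>The primal path\<close>

definition primal_path ::
  "real mat \<Rightarrow> real vec \<Rightarrow> (real \<Rightarrow> real vec) \<Rightarrow> real \<Rightarrow> real vec" where
  "primal_path X y u lam =
     mat_inv (transpose_mat X * X) *\<^sub>v (transpose_mat X *\<^sub>v y - u lam)"

end

theory Submission
  imports Defs
begin

text \<open>
  Write \<open>b\<close> for a coefficient vector and \<open>X\<^sup>T (y - X b)\<close> for its vector of correlations.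
  Both procedures follow the same curves.  Given distinct indices \<open>B\<close>, signs \<open>s\<close> and a level \<open>t\<close>,
  full column rank of \<open>X\<close> gives exactly one \<open>b\<close> that vanishes off \<open>B\<close> and whose correlations on
  \<open>B\<close> are \<open>t s\<close>; this is \<open>equicorrelated X y B s t\<close>.

  On the LARS side, the direction \<open>(X\<^sub>A\<^sup>T X\<^sub>A)\<^sup>-\<^sup>1 s\<close> changes the correlations on the active set by
  \<open>- s\<close> per unit of step length, so a move of length \<open>g\<close> from level \<open>t\<close> leads to level \<open>t - g\<close> of
  the same curve (\<open>lars_move_equicorrelated\<close>).

  On the dual side, \<open>D = X\<^sup>+\<close> is a left inverse of \<open>X\<close> with \<open>X D\<close> symmetric, hence
  \<open>D D\<^sup>T X\<^sup>T r = D r\<close> for every \<open>r\<close>.  Taking \<open>r = y - X b\<close>, the correlation vector \<open>u\<close> of a point of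
  the curve has \<open>D D\<^sup>T u = D y - b\<close>, which equals \<open>D y\<close> off \<open>B\<close>.
  Split according to \<open>B\<close> and its complement, this is the linear system solved by \<open>a - t b\<close> in the algorithm: off \<open>B\<close>, its lines are the correlations
  of the inactive variables (\<open>dual_line\<close>).  A hitting time is then a level at which an inactive
  variable ties with the active ones, and the primal path undoes the passage from \<open>b\<close> to \<open>u\<close>.

  It remains to match the events.  As long as no correlation exceeds the level, continuity
  ensures that every inactive variable is hit at some level in \<open>[0, L]\<close> and that it stays strictly
  below the level before its hitting time (\<open>hitting_time_finite\<close>).  So the largest hitting time is the
  level where LARS ends its step (\<open>lars_step_point\<close>), and the variables that tie there are the same.
  When a variable enters, the old curve and the new one meet at that level (\<open>point_extend\<close>), which
  keeps the correlations bounded by the level and makes the stages of the two procedures correspond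
  (\<open>lars_state_of_dstate\<close>, \<open>dstate_of_lars_state\<close>).

  Each level is reached, since at most \<open>p\<close> variables can enter (\<open>on_common_path_exists\<close>); and it determines
  its point, since two stages that contain one level are separated by stages of length zero only
  (\<open>on_common_path_agree\<close>).  If there are columns and \<open>y\<close> is orthogonal to all of them, then LARS starts with
  the sign \<open>0\<close> at level \<open>0\<close>, and its only stage matches no stage of positive level; but both paths are
  constantly \<open>0\<close>.
\<close>

section \<open>Matrices with trivial kernel\<close>

definition inj_mat :: "real mat \<Rightarrow> bool" where
  "inj_mat A \<longleftrightarrow> (\<forall>v \<in> carrier_vec (dim_col A). A *\<^sub>v v = 0\<^sub>v (dim_row A) \<longrightarrow> v = 0\<^sub>v (dim_col A))"

lemma inj_matD:
  assumes "inj_mat A" "A \<in> carrier_mat m k" "v \<in> carrier_vec k" "A *\<^sub>v v = 0\<^sub>v m"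
  shows "v = 0\<^sub>v k"
  using assms by (auto simp: inj_mat_def)

text \<open>
  The rank is the size of a maximal independent subset of the set of columns, and a repeated column
  would leave fewer than \<open>p\<close> vectors in that set.
\<close>
lemma full_column_rank_distinct_cols:
  fixes X :: "real mat"
  assumes X: "X \<in> carrier_mat n p" and r: "vec_space.rank n X = p"
  shows "distinct (cols X)"
proof (rule ccontr)
  interpret vec_space "TYPE(real)" n .
  assume "\<not> distinct (cols X)"
  hence less: "card (set (cols X)) < p"
    using X by (metis cols_length card_distinct card_length carrier_matD(2) le_neq_implies_less)
  obtain S where S: "maximal S (\<lambda>T. T \<subseteq> set (cols X) \<and> lin_indpt T)"
    using maximal_exists[of "(\<lambda>T. T \<subseteq> set (cols X) \<and> lin_indpt T)" "card (set (cols X))" "{}"]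
    by (meson List.finite_set card_mono empty_iff empty_subsetI finite_lin_indpt2 rev_finite_subset)
  have "card S = p" using rank_card_indpt[OF X S] r by simp
  moreover have "card S \<le> card (set (cols X))"
    using S by (auto simp: maximal_def intro: card_mono)
  ultimately show False using less by simp
qed

lemma full_column_rank_inj:
  fixes X :: "real mat"
  assumes X: "X \<in> carrier_mat n p" and r: "vec_space.rank n X = p"
  shows "inj_mat X"
proof -
  interpret vec_space "TYPE(real)" n .
  have d: "distinct (cols X)" by (rule full_column_rank_distinct_cols[OF X r])
  have "lin_indpt (set (cols X))" using full_rank_lin_indpt[OF X r d] .
  thus ?thesis using lin_depI[OF X _ _ _ d] X by (auto simp: inj_mat_def)
qed

lemma inj_mat_inverse:
  assumes A: "A \<in> carrier_mat k k" and inj: "inj_mat A"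
  shows "mat_inv A \<in> carrier_mat k k" "mat_inv A * A = 1\<^sub>m k" "A * mat_inv A = 1\<^sub>m k"
proof -
  have "det A \<noteq> 0"
    using det_0_iff_vec_prod_zero[OF A] inj_matD[OF inj A] by blast
  hence "A \<in> Units (ring_mat TYPE(real) k ())"
    by (rule det_non_zero_imp_unit[OF A])
  then obtain B where B: "mat_inverse A = Some B"
    using mat_inverse(1)[OF A, where b = "()"] by (cases "mat_inverse A") auto
  thus "mat_inv A \<in> carrier_mat k k" "mat_inv A * A = 1\<^sub>m k" "A * mat_inv A = 1\<^sub>m k"
    using mat_inverse(2)[OF A B] by (auto simp: mat_inv_def)
qed

text \<open>
  \<open>v \<bullet> (A\<^sup>T A v)\<close> is the squared norm of \<open>A v\<close>.
\<close>
lemma inj_gram: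
  assumes A: "A \<in> carrier_mat m k" and inj: "inj_mat A"
  shows "inj_mat (transpose_mat A * A)"
  unfolding inj_mat_def
proof (intro ballI impI)
  fix v assume v: "v \<in> carrier_vec (dim_col (transpose_mat A * A))"
    and z: "transpose_mat A * A *\<^sub>v v = 0\<^sub>v (dim_row (transpose_mat A * A))"
  have v': "v \<in> carrier_vec k" using v A by auto
  have Av: "A *\<^sub>v v \<in> carrier_vec m" using A v' by auto
  have "(transpose_mat A *\<^sub>v (A *\<^sub>v v)) = 0\<^sub>v k"
    using z A v' by (subst assoc_mult_mat_vec[symmetric, of _ k m _ k]) auto
  hence "(A *\<^sub>v v) \<bullet> (A *\<^sub>v v) = 0"
    using transpose_vec_mult_scalar[OF A v' Av] v' by auto
  hence "(A *\<^sub>v v) \<bullet>c (A *\<^sub>v v) = 0" by (simp add: conjugate_vec_def scalar_prod_def)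
  hence "A *\<^sub>v v = 0\<^sub>v m" using conjugate_square_eq_0_vec[OF Av] by blast
  thus "v = 0\<^sub>v (dim_col (transpose_mat A * A))" using inj_matD[OF inj A v'] A by auto
qed

text \<open>
  \<open>P\<close> is a left inverse of \<open>A\<close>, which gives three of the Penrose conditions; the symmetry of \<open>A P\<close>
  comes from that of the inverse Gram matrix.
\<close>
lemma is_pinv_full_column_rank:
  assumes A: "A \<in> carrier_mat m k" and inj: "inj_mat A"
  defines "P \<equiv> mat_inv (transpose_mat A * A) * transpose_mat A"
  shows "is_pinv A P" "P * A = 1\<^sub>m k"
proof -
  let ?T = "transpose_mat A" let ?G = "?T * A" let ?M = "mat_inv ?G"
  have T: "?T \<in> carrier_mat k m" using A by auto
  have G: "?G \<in> carrier_mat k k" using A by auto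
  note M = inj_mat_inverse[OF G inj_gram[OF A inj]]
  have Gs: "transpose_mat ?G = ?G" by (subst transpose_mult[OF T A]) simp
  have Ms: "transpose_mat ?M = ?M"
  proof -
    have Mt: "transpose_mat ?M \<in> carrier_mat k k" using M(1) by auto
    have "transpose_mat ?M * ?G = transpose_mat (?G * ?M)"
      by (subst transpose_mult[OF G M(1)]) (simp only: Gs)
    hence 1: "transpose_mat ?M * ?G = 1\<^sub>m k" using M(3) by simp
    have "transpose_mat ?M = transpose_mat ?M * (?G * ?M)" using Mt M(3) by simp
    also have "\<dots> = (transpose_mat ?M * ?G) * ?M"
      using assoc_mult_mat[OF Mt G M(1)] by simp
    also have "\<dots> = ?M" using 1 M(1) by simp
    finally show ?thesis .
  qed
  have P_eq: "P = ?M * ?T" by (simp add: P_def)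
  have P: "P \<in> carrier_mat k m" using M(1) T by (auto simp: P_eq)
  have PA: "P * A = 1\<^sub>m k" using assoc_mult_mat[OF M(1) T A] M(2) by (simp add: P_eq)
  have AP: "A * P \<in> carrier_mat m m" using A P by auto
  have Pt: "transpose_mat P = A * ?M"
    unfolding P_eq by (subst transpose_mult[OF M(1) T]) (simp add: Ms)
  have "transpose_mat (A * P) = A * ?M * ?T"
    by (subst transpose_mult[OF A P]) (simp only: Pt)
  also have "\<dots> = A * P" unfolding P_eq using assoc_mult_mat[OF A M(1) T] .
  finally have sym: "transpose_mat (A * P) = A * P" .
  show "is_pinv A P"
    unfolding is_pinv_def
  proof (intro conjI)
    show "P \<in> carrier_mat (dim_col A) (dim_row A)" using P A by auto
    show "A * P * A = A" using assoc_mult_mat[OF A P A] PA A by simp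
    show "P * A * P = P" unfolding PA by (rule left_mult_one_mat[OF P])
    show "transpose_mat (A * P) = A * P" by (rule sym)
    show "transpose_mat (P * A) = P * A" by (simp only: PA transpose_one)
  qed
  show "P * A = 1\<^sub>m k" by (rule PA)
qed

text \<open>
  For any pseudoinverse \<open>Q\<close>, symmetry of \<open>A Q\<close> turns \<open>A Q A = A\<close> into the normal equation
  \<open>A\<^sup>T A Q = A\<^sup>T\<close>, which determines \<open>Q\<close> because the Gram matrix is invertible.
\<close>
lemma pinv_full_column_rank_eq:
  assumes A: "A \<in> carrier_mat m k" and inj: "inj_mat A"
  shows "pinv A = mat_inv (transpose_mat A * A) * transpose_mat A" (is "_ = ?P")
  unfolding pinv_def
proof (rule the_equality)
  show "is_pinv A ?P" by (rule is_pinv_full_column_rank[OF A inj])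
  let ?T = "transpose_mat A" let ?G = "?T * A" let ?M = "mat_inv ?G"
  have T: "?T \<in> carrier_mat k m" and G: "?G \<in> carrier_mat k k" using A by auto
  note M = inj_mat_inverse[OF G inj_gram[OF A inj]]
  fix Q assume "is_pinv A Q"
  hence Q: "Q \<in> carrier_mat k m" and q: "A * Q * A = A" "transpose_mat (A * Q) = A * Q"
    using A unfolding is_pinv_def by auto
  have AQ: "A * Q \<in> carrier_mat m m" using A Q by auto
  have "transpose_mat (A * Q * A) = ?T * (A * Q)"
    by (subst transpose_mult[OF AQ A]) (simp only: q)
  hence "?T * (A * Q) = ?T" using q(1) by simp
  hence "?P = ?M * (?T * (A * Q))" by simp
  also have "\<dots> = ?M * (?G * Q)" using assoc_mult_mat[OF T A Q] by simp
  also have "\<dots> = (?M * ?G) * Q" using assoc_mult_mat[OF M(1) G Q] by simp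
  also have "\<dots> = Q" using M(2) Q by simp
  finally show "Q = ?P" by simp
qed

lemma pinv_full_column_rank:
  assumes A: "A \<in> carrier_mat m k" and inj: "inj_mat A"
  shows "pinv A \<in> carrier_mat k m" "pinv A * A = 1\<^sub>m k"
    "transpose_mat (A * pinv A) = A * pinv A"
  using is_pinv_full_column_rank[OF A inj] A
  unfolding is_pinv_def pinv_full_column_rank_eq[OF A inj] by auto

lemma pinv_mult_vec:
  assumes A: "A \<in> carrier_mat m k" and inj: "inj_mat A" and v: "v \<in> carrier_vec k"
  shows "pinv A *\<^sub>v (A *\<^sub>v v) = v"
  using assoc_mult_mat_vec[OF pinv_full_column_rank(1)[OF A inj] A v]
    pinv_full_column_rank(2)[OF A inj] v by simp

section \<open>Selecting coordinates\<close>

text \<open>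
  Multiplication by \<open>sel p I\<close> places a vector at the coordinates \<open>I\<close> and fills up with zeros; its
  transpose restricts to \<open>I\<close>.  Products with it replace all submatrices of the algorithms, so that
  their identities become matrix algebra.
\<close>
definition sel :: "nat \<Rightarrow> nat list \<Rightarrow> real mat" where
  "sel p I = mat_of_cols p (map (unit_vec p) I)"

lemma dim_sel [simp]: "dim_row (sel p I) = p" "dim_col (sel p I) = length I"
  by (simp_all add: sel_def)

lemma sel_carrier [simp]: "sel p I \<in> carrier_mat p (length I)"
  by (rule carrier_matI) simp_all

lemma sub_vec_carrier [simp]: "sub_vec v I \<in> carrier_vec (length I)"
  unfolding sub_vec_def by (metis carrier_vecI dim_vec_of_list length_map)

lemma dim_sub_vec [simp]: "dim_vec (sub_vec v I) = length I"
  by (simp add: sub_vec_def)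

lemma sub_vec_index [simp]: "k < length I \<Longrightarrow> sub_vec v I $ k = v $ (I ! k)"
  by (simp add: sub_vec_def vec_of_list_index)

lemma col_sel: "k < length I \<Longrightarrow> I ! k < p \<Longrightarrow> col (sel p I) k = unit_vec p (I ! k)"
  by (simp add: sel_def col_mat_of_cols)

lemma transpose_sel_mult:
  assumes "set I \<subseteq> {..<p}" "v \<in> carrier_vec p"
  shows "transpose_mat (sel p I) *\<^sub>v v = sub_vec v I"
proof (rule eq_vecI)
  fix k assume k: "k < dim_vec (sub_vec v I)"
  hence "I ! k < p" using assms(1) nth_mem by auto
  thus "(transpose_mat (sel p I) *\<^sub>v v) $ k = sub_vec v I $ k"
    using k assms(2) by (simp add: col_sel)
qed simp

lemma sub_cols_eq:
  assumes X: "X \<in> carrier_mat n p" and I: "set I \<subseteq> {..<p}"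
  shows "sub_cols X I = X * sel p I"
proof (rule eq_matI)
  fix i k assume "i < dim_row (X * sel p I)" "k < dim_col (X * sel p I)"
  hence i: "i < n" and k: "k < length I" using X by auto
  hence "I ! k < p" using I nth_mem by auto
  thus "sub_cols X I $$ (i, k) = (X * sel p I) $$ (i, k)"
    using X i k by (simp add: sub_cols_def mat_of_cols_index col_sel)
qed (use X in \<open>auto simp: sub_cols_def\<close>)

lemma sub_rows_eq:
  assumes D: "D \<in> carrier_mat p n" and I: "set I \<subseteq> {..<p}"
  shows "sub_rows D I = transpose_mat (sel p I) * D"
proof (rule eq_matI)
  fix k i assume "k < dim_row (transpose_mat (sel p I) * D)"
    "i < dim_col (transpose_mat (sel p I) * D)"
  hence i: "i < n" and k: "k < length I" using D by auto
  hence "I ! k < p" using I nth_mem by auto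
  thus "sub_rows D I $$ (k, i) = (transpose_mat (sel p I) * D) $$ (k, i)"
    using D i k by (simp add: sub_rows_def mat_of_rows_index col_sel)
qed (use D in \<open>auto simp: sub_rows_def\<close>)

lemma sel_mult_index:
  assumes j: "j < p" and w: "w \<in> carrier_vec (length I)"
  shows "(sel p I *\<^sub>v w) $ j = (\<Sum>k<length I. if I ! k = j then w $ k else 0)"
proof -
  have "(sel p I *\<^sub>v w) $ j = (\<Sum>k<length I. sel p I $$ (j, k) * w $ k)"
    using j w by (simp add: scalar_prod_def row_def lessThan_atLeast0)
  also have "\<dots> = (\<Sum>k<length I. if I ! k = j then w $ k else 0)"
    using j by (intro sum.cong) (auto simp: sel_def mat_of_cols_index unit_vec_def)
  finally show ?thesis .
qed

lemma sel_mult_nth: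
  assumes d: "distinct I" and I: "set I \<subseteq> {..<p}" and w: "w \<in> carrier_vec (length I)"
    and k: "k < length I"
  shows "(sel p I *\<^sub>v w) $ (I ! k) = w $ k"
proof -
  have "I ! k < p" using I k nth_mem by auto
  hence "(sel p I *\<^sub>v w) $ (I ! k) = (\<Sum>l<length I. if I ! l = I ! k then w $ l else 0)"
    by (rule sel_mult_index[OF _ w])
  also have "\<dots> = (\<Sum>l<length I. if l = k then w $ l else 0)"
    using d k by (intro sum.cong) (auto simp: nth_eq_iff_index_eq)
  finally show ?thesis using k by simp
qed

lemma sel_mult_notin:
  assumes "j < p" "j \<notin> set I" "w \<in> carrier_vec (length I)"
  shows "(sel p I *\<^sub>v w) $ j = 0"
proof -
  have "(\<Sum>k<length I. if I ! k = j then w $ k else 0) = 0"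
    using assms(2) by (intro sum.neutral) auto
  thus ?thesis using sel_mult_index[OF assms(1,3)] by simp
qed

lemma inj_sel:
  assumes "distinct I" "set I \<subseteq> {..<p}"
  shows "inj_mat (sel p I)"
  unfolding inj_mat_def
proof (intro ballI impI)
  fix w assume "w \<in> carrier_vec (dim_col (sel p I))"
    and z: "sel p I *\<^sub>v w = 0\<^sub>v (dim_row (sel p I))"
  hence w: "w \<in> carrier_vec (length I)" by simp
  show "w = 0\<^sub>v (dim_col (sel p I))"
  proof (rule eq_vecI)
    fix k assume "k < dim_vec (0\<^sub>v (dim_col (sel p I)) :: real vec)"
    hence k: "k < length I" by simp
    hence "I ! k < p" using assms(2) nth_mem by auto
    thus "w $ k = 0\<^sub>v (dim_col (sel p I)) $ k"
      using sel_mult_nth[OF assms w k] z k by simp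
  qed (use w in simp)
qed

lemma sel_sub_vec:
  assumes "distinct I" "set I \<subseteq> {..<p}" "v \<in> carrier_vec p"
    and "\<And>j. j < p \<Longrightarrow> j \<notin> set I \<Longrightarrow> v $ j = 0"
  shows "sel p I *\<^sub>v sub_vec v I = v"
proof (rule eq_vecI)
  fix j assume "j < dim_vec v"
  hence j: "j < p" using assms(3) by simp
  show "(sel p I *\<^sub>v sub_vec v I) $ j = v $ j"
  proof (cases "j \<in> set I")
    case True
    then obtain k where "k < length I" "j = I ! k" by (auto simp: in_set_conv_nth)
    thus ?thesis using sel_mult_nth[OF assms(1,2) sub_vec_carrier] by simp
  next
    case False
    thus ?thesis using sel_mult_notin[OF j _ sub_vec_carrier] assms(4) j by simp
  qed
qed (use assms in simp)

lemma remaining_props: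
  "set (remaining p B) = {j. j < p \<and> j \<notin> set B}" "distinct (remaining p B)"
  "set (remaining p B) \<subseteq> {..<p}"
  by (auto simp: remaining_def)

lemma sel_split:
  assumes "distinct B" "set B \<subseteq> {..<p}" "u \<in> carrier_vec p"
  shows "sel p B *\<^sub>v sub_vec u B + sel p (remaining p B) *\<^sub>v sub_vec u (remaining p B) = u"
    (is "?b + ?r = u")
proof (rule eq_vecI)
  fix j assume "j < dim_vec u"
  hence j: "j < p" using assms(3) by simp
  note R = remaining_props[of p B]
  show "(?b + ?r) $ j = u $ j"
  proof (cases "j \<in> set B")
    case True
    then obtain k where k: "k < length B" "j = B ! k" by (auto simp: in_set_conv_nth)
    have "?r $ j = 0" using True R(1) by (intro sel_mult_notin[OF j]) auto
    thus ?thesis using sel_mult_nth[OF assms(1,2) sub_vec_carrier k(1), of u] k j by simp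
  next
    case False
    then obtain k where k: "k < length (remaining p B)" "j = remaining p B ! k"
      using j R(1) by (metis (mono_tags, lifting) in_set_conv_nth mem_Collect_eq)
    have "?b $ j = 0" using False by (intro sel_mult_notin[OF j]) auto
    thus ?thesis using sel_mult_nth[OF R(2,3) sub_vec_carrier k(1), of u] k j by simp
  qed
qed (use assms in simp)

section \<open>Equicorrelated points\<close>

text \<open>
  The vector supported on \<open>A\<close> whose image under \<open>X\<^sup>T X\<close> agrees with \<open>w\<close> on \<open>A\<close>
  (lemmas \<open>supported_solution\<close> and \<open>supported_solution_unique\<close> below).
\<close>
definition supported_solution :: "real mat \<Rightarrow> nat list \<Rightarrow> real vec \<Rightarrow> real vec" where
  "supported_solution X A w =
     sel (dim_col X) A *\<^sub>v (mat_inv (transpose_mat (sub_cols X A) * sub_cols X A) *\<^sub>v w)"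

definition equicorrelated :: "real mat \<Rightarrow> real vec \<Rightarrow> nat list \<Rightarrow> real list \<Rightarrow> real \<Rightarrow> real vec" where
  "equicorrelated X y A s t =
     supported_solution X A (sub_vec (transpose_mat X *\<^sub>v y) A - t \<cdot>\<^sub>v vec_of_list s)"

lemma lars_direction_eq: "lars_direction X A s = supported_solution X A (vec_of_list s)"
  by (simp add: lars_direction_def supported_solution_def sel_def)

locale regression =
  fixes X :: "real mat" and y :: "real vec" and n p :: nat
  assumes X: "X \<in> carrier_mat n p" and y: "y \<in> carrier_vec n" and inj: "inj_mat X"
begin

abbreviation Xt :: "real mat" where "Xt \<equiv> transpose_mat X"
abbreviation point :: "nat list \<Rightarrow> real list \<Rightarrow> real \<Rightarrow> real vec" where
  "point \<equiv> equicorrelated X y"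
abbreviation corr :: "real vec \<Rightarrow> nat \<Rightarrow> real" where "corr \<equiv> correlation X y"

lemma Xt: "Xt \<in> carrier_mat p n" using X by simp
lemma dims [simp]: "dim_row X = n" "dim_col X = p" "dim_vec y = n" using X y by auto
lemma X_mult [simp]: "v \<in> carrier_vec p \<Longrightarrow> X *\<^sub>v v \<in> carrier_vec n"
  by (rule mult_mat_vec_carrier[OF X])
lemma Xt_mult [simp]: "v \<in> carrier_vec n \<Longrightarrow> Xt *\<^sub>v v \<in> carrier_vec p"
  by (rule mult_mat_vec_carrier[OF Xt])

definition admissible :: "nat list \<Rightarrow> real list \<Rightarrow> bool" where
  "admissible A s \<longleftrightarrow> distinct A \<and> set A \<subseteq> {..<p} \<and> length s = length A"

lemma sub_cols_mult:
  assumes A: "set A \<subseteq> {..<p}" and z: "z \<in> carrier_vec (length A)"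
  shows "(transpose_mat (sub_cols X A) * sub_cols X A) *\<^sub>v z =
    sub_vec (Xt *\<^sub>v (X *\<^sub>v (sel p A *\<^sub>v z))) A"
proof -
  note eq = sub_cols_eq[OF X A]
  have C: "sub_cols X A \<in> carrier_mat n (length A)"
    unfolding eq by (rule mult_carrier_mat[OF X sel_carrier])
  have Sz: "sel p A *\<^sub>v z \<in> carrier_vec p" by (rule mult_mat_vec_carrier[OF sel_carrier z])
  have St: "transpose_mat (sel p A) \<in> carrier_mat (length A) p" by simp
  have 1: "sub_cols X A *\<^sub>v z = X *\<^sub>v (sel p A *\<^sub>v z)"
    unfolding eq by (rule assoc_mult_mat_vec[OF X sel_carrier z])
  have "(transpose_mat (sub_cols X A) * sub_cols X A) *\<^sub>v z =
      transpose_mat (sub_cols X A) *\<^sub>v (sub_cols X A *\<^sub>v z)"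
    by (rule assoc_mult_mat_vec[OF _ C z]) (use C in simp)
  also have "\<dots> = (transpose_mat (sel p A) * Xt) *\<^sub>v (X *\<^sub>v (sel p A *\<^sub>v z))"
    unfolding 1 unfolding eq transpose_mult[OF X sel_carrier] ..
  also have "\<dots> = transpose_mat (sel p A) *\<^sub>v (Xt *\<^sub>v (X *\<^sub>v (sel p A *\<^sub>v z)))"
    using Sz by (intro assoc_mult_mat_vec[OF St Xt]) simp
  also have "\<dots> = sub_vec (Xt *\<^sub>v (X *\<^sub>v (sel p A *\<^sub>v z))) A"
    using Sz by (intro transpose_sel_mult[OF A]) simp
  finally show ?thesis .
qed

lemma inj_sub_cols:
  assumes "distinct A" and A: "set A \<subseteq> {..<p}"
  shows "inj_mat (sub_cols X A)"
  unfolding inj_mat_def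
proof (intro ballI impI)
  note eq = sub_cols_eq[OF X A]
  fix z assume "z \<in> carrier_vec (dim_col (sub_cols X A))"
    and 0: "sub_cols X A *\<^sub>v z = 0\<^sub>v (dim_row (sub_cols X A))"
  hence z: "z \<in> carrier_vec (length A)" by (simp add: eq)
  have Sz: "sel p A *\<^sub>v z \<in> carrier_vec p" by (rule mult_mat_vec_carrier[OF sel_carrier z])
  have "X *\<^sub>v (sel p A *\<^sub>v z) = 0\<^sub>v n"
    using 0 assoc_mult_mat_vec[OF X sel_carrier z] by (simp add: eq)
  hence "sel p A *\<^sub>v z = 0\<^sub>v p" by (rule inj_matD[OF inj X Sz])
  thus "z = 0\<^sub>v (dim_col (sub_cols X A))"
    using inj_matD[OF inj_sel[OF assms] sel_carrier z] by (simp add: eq)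
qed

lemma sub_gram_inverse:
  assumes "distinct A" and A: "set A \<subseteq> {..<p}"
  defines "G \<equiv> transpose_mat (sub_cols X A) * sub_cols X A"
  shows "G \<in> carrier_mat (length A) (length A)"
    "mat_inv G \<in> carrier_mat (length A) (length A)"
    "mat_inv G * G = 1\<^sub>m (length A)" "G * mat_inv G = 1\<^sub>m (length A)"
proof -
  have C: "sub_cols X A \<in> carrier_mat n (length A)"
    unfolding sub_cols_eq[OF X A] by (rule mult_carrier_mat[OF X sel_carrier])
  show G: "G \<in> carrier_mat (length A) (length A)"
    unfolding G_def using C by auto
  show "mat_inv G \<in> carrier_mat (length A) (length A)"
    "mat_inv G * G = 1\<^sub>m (length A)" "G * mat_inv G = 1\<^sub>m (length A)"
    using inj_mat_inverse[OF G] inj_gram[OF C inj_sub_cols[OF assms(1,2)]]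
    unfolding G_def by auto
qed

lemma supported_solution:
  assumes d: "distinct A" and A: "set A \<subseteq> {..<p}" and w: "w \<in> carrier_vec (length A)"
  defines "b \<equiv> supported_solution X A w"
  shows "b \<in> carrier_vec p" "\<And>j. j < p \<Longrightarrow> j \<notin> set A \<Longrightarrow> b $ j = 0"
    "sub_vec (Xt *\<^sub>v (X *\<^sub>v b)) A = w"
proof -
  let ?G = "transpose_mat (sub_cols X A) * sub_cols X A"
  note M = sub_gram_inverse[OF d A]
  let ?z = "mat_inv ?G *\<^sub>v w"
  have z: "?z \<in> carrier_vec (length A)" by (rule mult_mat_vec_carrier[OF M(2) w])
  have b: "b = sel p A *\<^sub>v ?z" by (simp add: b_def supported_solution_def)
  show "b \<in> carrier_vec p" unfolding b by (rule mult_mat_vec_carrier[OF sel_carrier z])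
  show "b $ j = 0" if "j < p" "j \<notin> set A" for j
    unfolding b using that by (rule sel_mult_notin[OF _ _ z])
  have "sub_vec (Xt *\<^sub>v (X *\<^sub>v b)) A = ?G *\<^sub>v ?z"
    unfolding b by (rule sub_cols_mult[OF A z, symmetric])
  also have "\<dots> = (?G * mat_inv ?G) *\<^sub>v w"
    by (rule assoc_mult_mat_vec[OF M(1,2) w, symmetric])
  also have "\<dots> = w" unfolding M(4) using w by simp
  finally show "sub_vec (Xt *\<^sub>v (X *\<^sub>v b)) A = w" .
qed

lemma supported_solution_unique:
  assumes d: "distinct A" and A: "set A \<subseteq> {..<p}" and b: "b \<in> carrier_vec p"
    and z: "\<And>j. j < p \<Longrightarrow> j \<notin> set A \<Longrightarrow> b $ j = 0"
  shows "b = supported_solution X A (sub_vec (Xt *\<^sub>v (X *\<^sub>v b)) A)"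
proof -
  let ?G = "transpose_mat (sub_cols X A) * sub_cols X A"
  note M = sub_gram_inverse[OF d A]
  have S: "sel p A *\<^sub>v sub_vec b A = b" by (rule sel_sub_vec[OF d A b z])
  have "mat_inv ?G *\<^sub>v sub_vec (Xt *\<^sub>v (X *\<^sub>v b)) A = mat_inv ?G *\<^sub>v (?G *\<^sub>v sub_vec b A)"
    using sub_cols_mult[OF A sub_vec_carrier, of b] S by simp
  also have "\<dots> = (mat_inv ?G * ?G) *\<^sub>v sub_vec b A"
    by (rule assoc_mult_mat_vec[OF M(2,1) sub_vec_carrier, symmetric])
  also have "\<dots> = sub_vec b A" unfolding M(3) by simp
  finally show ?thesis using S by (simp add: supported_solution_def)
qed

lemma correlation_eq_normal:
  assumes b: "b \<in> carrier_vec p" and j: "j < p"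
  shows "corr b j = (Xt *\<^sub>v y) $ j - (Xt *\<^sub>v (X *\<^sub>v b)) $ j"
proof -
  have c: "col X j \<in> carrier_vec n" by (rule carrier_vecI) simp
  have "corr b j = col X j \<bullet> y - col X j \<bullet> (X *\<^sub>v b)"
    unfolding correlation_def by (rule scalar_prod_minus_distrib[OF c y X_mult[OF b]])
  thus ?thesis using j by simp
qed

lemma equicorrelated_sub_vec:
  assumes "admissible A s"
  shows "sub_vec (Xt *\<^sub>v y) A - t \<cdot>\<^sub>v vec_of_list s \<in> carrier_vec (length A)"
  by (rule carrier_vecI) (use assms in \<open>simp add: admissible_def\<close>)

lemma equicorrelated:
  assumes ad: "admissible A s"
  shows "point A s t \<in> carrier_vec p"
    "j < p \<Longrightarrow> j \<notin> set A \<Longrightarrow> point A s t $ j = 0"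
    "k < length A \<Longrightarrow> corr (point A s t) (A ! k) = t * s ! k"
proof -
  have d: "distinct A" and A: "set A \<subseteq> {..<p}" and l: "length s = length A"
    using ad by (auto simp: admissible_def)
  note S = supported_solution[OF d A equicorrelated_sub_vec[OF ad, of t],
      folded equicorrelated_def]
  show P: "point A s t \<in> carrier_vec p" by (rule S(1))
  show "j < p \<Longrightarrow> j \<notin> set A \<Longrightarrow> point A s t $ j = 0" by (rule S(2))
  assume k: "k < length A"
  hence Ak: "A ! k < p" using A nth_mem by auto
  have "(Xt *\<^sub>v (X *\<^sub>v point A s t)) $ (A ! k) =
      (sub_vec (Xt *\<^sub>v y) A - t \<cdot>\<^sub>v vec_of_list s) $ k"
    unfolding S(3)[symmetric] using k by simp
  also have "\<dots> = (Xt *\<^sub>v y) $ (A ! k) - t * s ! k"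
    using k l by (simp add: vec_of_list_index)
  finally show "corr (point A s t) (A ! k) = t * s ! k"
    using correlation_eq_normal[OF P Ak] by simp
qed

lemma equicorrelated_unique:
  assumes ad: "admissible A s" and b: "b \<in> carrier_vec p"
    and z: "\<And>j. j < p \<Longrightarrow> j \<notin> set A \<Longrightarrow> b $ j = 0"
    and c: "\<And>k. k < length A \<Longrightarrow> corr b (A ! k) = t * s ! k"
  shows "b = point A s t"
proof -
  have d: "distinct A" and A: "set A \<subseteq> {..<p}" and l: "length s = length A"
    using ad by (auto simp: admissible_def)
  have "sub_vec (Xt *\<^sub>v (X *\<^sub>v b)) A = sub_vec (Xt *\<^sub>v y) A - t \<cdot>\<^sub>v vec_of_list s"
  proof (rule eq_vecI)
    fix k assume "k < dim_vec (sub_vec (Xt *\<^sub>v y) A - t \<cdot>\<^sub>v vec_of_list s)"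
    hence k: "k < length A" using l by simp
    hence Ak: "A ! k < p" using A nth_mem by auto
    show "sub_vec (Xt *\<^sub>v (X *\<^sub>v b)) A $ k =
        (sub_vec (Xt *\<^sub>v y) A - t \<cdot>\<^sub>v vec_of_list s) $ k"
      using c[OF k] k l unfolding correlation_eq_normal[OF b Ak]
      by (simp add: vec_of_list_index del: index_mult_mat_vec)
  qed (use l in simp)
  thus ?thesis
    using supported_solution_unique[OF d A b z] by (simp add: equicorrelated_def)
qed

text \<open>
  The LARS direction is itself a supported solution, for the right-hand side \<open>s\<close>; so it lowers each
  active correlation at rate \<open>s\<close>, and uniqueness identifies the point reached.
\<close>
lemma lars_move_equicorrelated:
  assumes ad: "admissible A s"
  shows "lars_move X A s (point A s t) g = point A s (t - g)"
proof (rule equicorrelated_unique[OF ad])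
  have d: "distinct A" and A: "set A \<subseteq> {..<p}" and l: "length s = length A"
    using ad by (auto simp: admissible_def)
  have s: "vec_of_list s \<in> carrier_vec (length A)" by (rule carrier_vecI) (simp add: l)
  let ?d = "lars_direction X A s"
  note D = supported_solution[OF d A s, folded lars_direction_eq]
  note P = equicorrelated[OF ad]
  have gd: "g \<cdot>\<^sub>v ?d \<in> carrier_vec p" using D(1) by simp
  show M: "lars_move X A s (point A s t) g \<in> carrier_vec p"
    unfolding lars_move_def using P(1) gd by simp
  show "lars_move X A s (point A s t) g $ j = 0" if "j < p" "j \<notin> set A" for j
    unfolding lars_move_def using P(1)[of t] D(1) that by (simp add: P(2) D(2))
  fix k assume k: "k < length A"
  hence Ak: "A ! k < p" using A nth_mem by auto
  have X1: "X *\<^sub>v (point A s t + g \<cdot>\<^sub>v ?d) = X *\<^sub>v point A s t + g \<cdot>\<^sub>v (X *\<^sub>v ?d)"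
    unfolding mult_add_distrib_mat_vec[OF X P(1) gd] mult_mat_vec[OF X D(1)] ..
  have "Xt *\<^sub>v (X *\<^sub>v (point A s t + g \<cdot>\<^sub>v ?d)) =
      Xt *\<^sub>v (X *\<^sub>v point A s t) + g \<cdot>\<^sub>v (Xt *\<^sub>v (X *\<^sub>v ?d))"
    unfolding X1
    by (subst mult_add_distrib_mat_vec[OF Xt X_mult[OF P(1)] smult_carrier_vec[THEN iffD2, OF X_mult[OF D(1)]]])
      (simp only: mult_mat_vec[OF Xt X_mult[OF D(1)]])
  moreover have "(Xt *\<^sub>v (X *\<^sub>v ?d)) $ (A ! k) = s ! k"
  proof -
    have "(Xt *\<^sub>v (X *\<^sub>v ?d)) $ (A ! k) = sub_vec (Xt *\<^sub>v (X *\<^sub>v ?d)) A $ k" using k by simp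
    thus ?thesis unfolding D(3) using k l by (simp add: vec_of_list_index)
  qed
  ultimately have "(Xt *\<^sub>v (X *\<^sub>v (point A s t + g \<cdot>\<^sub>v ?d))) $ (A ! k) =
      (Xt *\<^sub>v (X *\<^sub>v point A s t)) $ (A ! k) + g * s ! k"
    using Ak by (simp del: index_mult_mat_vec)
  thus "corr (lars_move X A s (point A s t) g) (A ! k) = (t - g) * s ! k"
    using P(3)[OF k, of t] correlation_eq_normal[OF P(1) Ak, of t] correlation_eq_normal[OF M Ak]
    unfolding lars_move_def by (simp add: algebra_simps del: index_mult_mat_vec)
qed

section \<open>The lines of the dual path\<close>

abbreviation dual_data :: "real vec" where "dual_data \<equiv> X *\<^sub>v (pinv X *\<^sub>v y)"
abbreviation corr_vec :: "real vec \<Rightarrow> real vec" where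
  "corr_vec b \<equiv> Xt *\<^sub>v (y - X *\<^sub>v b)"

lemma corr_vec_index: "j < p \<Longrightarrow> corr_vec b $ j = corr b j"
  by (simp add: correlation_def)

lemma pinv_X: "pinv X \<in> carrier_mat p n" "pinv X * X = 1\<^sub>m p"
    "transpose_mat (X * pinv X) = X * pinv X"
  using pinv_full_column_rank[OF X inj] .

lemma dim_pinv_X [simp]: "dim_row (pinv X) = p" "dim_col (pinv X) = n"
  using pinv_X(1) by auto

lemma pinv_mult_X: "v \<in> carrier_vec p \<Longrightarrow> pinv X *\<^sub>v (X *\<^sub>v v) = v"
  by (rule pinv_mult_vec[OF X inj])

text \<open>
  Since \<open>X X\<^sup>+\<close> is symmetric, \<open>(X\<^sup>+)\<^sup>T X\<^sup>T = X X\<^sup>+\<close>, the projection onto the column space, and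
  \<open>X\<^sup>+\<close> does not change under it.
\<close>
lemma pinv_transpose_mult:
  assumes r: "r \<in> carrier_vec n"
  shows "pinv X *\<^sub>v (transpose_mat (pinv X) *\<^sub>v (Xt *\<^sub>v r)) = pinv X *\<^sub>v r"
proof -
  have Dt: "transpose_mat (pinv X) \<in> carrier_mat n p" using pinv_X(1) by simp
  have Dr: "pinv X *\<^sub>v r \<in> carrier_vec p" using pinv_X(1) r by simp
  have "transpose_mat (pinv X) *\<^sub>v (Xt *\<^sub>v r) = transpose_mat (X * pinv X) *\<^sub>v r"
    unfolding transpose_mult[OF X pinv_X(1)]
    by (rule assoc_mult_mat_vec[OF Dt Xt r, symmetric])
  also have "\<dots> = X *\<^sub>v (pinv X *\<^sub>v r)"
    unfolding pinv_X(3) by (rule assoc_mult_mat_vec[OF X pinv_X(1) r])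
  finally show ?thesis using pinv_mult_X[OF Dr] by simp
qed

lemma sub_vec_corr_vec:
  assumes ad: "admissible B s"
  shows "sub_vec (corr_vec (point B s t)) B = t \<cdot>\<^sub>v vec_of_list s"
proof (rule eq_vecI)
  have B: "set B \<subseteq> {..<p}" and l: "length s = length B"
    using ad by (auto simp: admissible_def)
  fix k assume "k < dim_vec (t \<cdot>\<^sub>v vec_of_list s)"
  hence k: "k < length B" using l by simp
  hence Bk: "B ! k < p" using B nth_mem by auto
  show "sub_vec (corr_vec (point B s t)) B $ k = (t \<cdot>\<^sub>v vec_of_list s) $ k"
    using equicorrelated(3)[OF ad k, of t] k l corr_vec_index[OF Bk, of "point B s t"]
    by (simp add: vec_of_list_index del: index_mult_mat_vec)
qed (use ad in \<open>simp add: admissible_def\<close>)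

text \<open>
  The correlation vector \<open>u\<close> of the equicorrelated point satisfies \<open>D D\<^sup>T u = D y - point\<close>, whose
  coordinates off \<open>B\<close> are those of \<open>D y\<close>.  With \<open>E\<close> the remaining rows of \<open>D\<close> and \<open>F\<close> the transpose of the
  boundary rows, this reads \<open>E E\<^sup>T u\<^sub>R + t E F s = E D\<^sup>T u = E X D y\<close>.  Now \<open>E\<^sup>T\<close> is injective because \<open>X\<^sup>T\<close> is a
  left inverse of \<open>D\<^sup>T\<close>; hence so is \<open>E E\<^sup>T\<close>, and its pseudoinverse isolates \<open>u\<^sub>R\<close>.
\<close>
lemma dual_line:
  assumes ad: "admissible B s"
  shows "sub_vec (corr_vec (point B s t)) (remaining p B) =
    dual_a dual_data (pinv X) B - t \<cdot>\<^sub>v dual_b (pinv X) B s"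
proof -
  have d: "distinct B" and B: "set B \<subseteq> {..<p}" and l: "length s = length B"
    using ad by (auto simp: admissible_def)
  let ?R = "remaining p B" let ?D = "pinv X" let ?b = "point B s t" let ?u = "corr_vec ?b"
  let ?S = "sel p ?R" let ?sv = "vec_of_list s"
  note R = remaining_props(2,3)[of p B]
  note D = pinv_X(1)
  note P = equicorrelated[OF ad]
  have Dt: "transpose_mat ?D \<in> carrier_mat n p" using D by simp
  have sv: "?sv \<in> carrier_vec (length B)" by (rule carrier_vecI) (simp add: l)
  have r: "y - X *\<^sub>v ?b \<in> carrier_vec n" using y P(1) by simp
  have u: "?u \<in> carrier_vec p" by (rule Xt_mult[OF r])
  have y': "?D *\<^sub>v y \<in> carrier_vec p" using D y by simp
  have yt: "dual_data \<in> carrier_vec n" by (rule X_mult[OF y'])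
  define E where "E = sub_rows ?D ?R"
  define F where "F = transpose_mat (sub_rows ?D B)"
  have E_eq: "E = transpose_mat ?S * ?D" unfolding E_def by (rule sub_rows_eq[OF D R(2)])
  have E: "E \<in> carrier_mat (length ?R) n"
    unfolding E_eq
    by (rule mult_carrier_mat[OF transpose_carrier_mat[THEN iffD2, OF sel_carrier] D])
  have E_mult: "E *\<^sub>v v = sub_vec (?D *\<^sub>v v) ?R" if v: "v \<in> carrier_vec n" for v
  proof -
    have "E *\<^sub>v v = transpose_mat ?S *\<^sub>v (?D *\<^sub>v v)"
      unfolding E_eq
      by (rule assoc_mult_mat_vec[OF transpose_carrier_mat[THEN iffD2, OF sel_carrier] D v])
    thus ?thesis using transpose_sel_mult[OF R(2)] mult_mat_vec_carrier[OF D v] by simp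
  qed
  have Et: "transpose_mat E \<in> carrier_mat n (length ?R)" using E by simp
  have Et_mult: "transpose_mat E *\<^sub>v z = transpose_mat ?D *\<^sub>v (?S *\<^sub>v z)"
    if z: "z \<in> carrier_vec (length ?R)" for z
  proof -
    have "transpose_mat E = transpose_mat ?D * ?S"
      unfolding E_eq by (subst transpose_mult[OF transpose_carrier_mat[THEN iffD2, OF sel_carrier] D]) simp
    thus ?thesis using assoc_mult_mat_vec[OF Dt sel_carrier z] by simp
  qed
  have F_eq: "F = transpose_mat ?D * sel p B"
    unfolding F_def sub_rows_eq[OF D B]
    by (subst transpose_mult[OF transpose_carrier_mat[THEN iffD2, OF sel_carrier] D]) simp
  have F: "F \<in> carrier_mat n (length B)"
    unfolding F_eq by (rule mult_carrier_mat[OF Dt sel_carrier])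
  have F_mult: "F *\<^sub>v z = transpose_mat ?D *\<^sub>v (sel p B *\<^sub>v z)"
    if z: "z \<in> carrier_vec (length B)" for z
    unfolding F_eq by (rule assoc_mult_mat_vec[OF Dt sel_carrier z])
  have inj_Et: "inj_mat (transpose_mat E)"
    unfolding inj_mat_def
  proof (intro ballI impI)
    fix z assume "z \<in> carrier_vec (dim_col (transpose_mat E))"
      and 0: "transpose_mat E *\<^sub>v z = 0\<^sub>v (dim_row (transpose_mat E))"
    hence z: "z \<in> carrier_vec (length ?R)" using E by simp
    have Sz: "?S *\<^sub>v z \<in> carrier_vec p" by (rule mult_mat_vec_carrier[OF sel_carrier z])
    have "Xt * transpose_mat ?D = 1\<^sub>m p"
      using transpose_mult[OF D X] pinv_X(2) by simp
    hence "?S *\<^sub>v z = (Xt * transpose_mat ?D) *\<^sub>v (?S *\<^sub>v z)" using Sz by simp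
    also have "\<dots> = Xt *\<^sub>v (transpose_mat E *\<^sub>v z)"
      unfolding Et_mult[OF z] by (rule assoc_mult_mat_vec[OF Xt Dt Sz])
    also have "\<dots> = 0\<^sub>v p"
    proof -
      have "transpose_mat E *\<^sub>v z = 0\<^sub>v n" unfolding 0 using E by simp
      moreover have "Xt *\<^sub>v 0\<^sub>v n = 0\<^sub>v p"
        by (rule eq_vecI) (auto simp: scalar_prod_def)
      ultimately show ?thesis by simp
    qed
    finally have "?S *\<^sub>v z = 0\<^sub>v p" .
    hence "z = 0\<^sub>v (length ?R)" by (rule inj_matD[OF inj_sel[OF R] sel_carrier z])
    thus "z = 0\<^sub>v (dim_col (transpose_mat E))" using E by simp
  qed
  define K where "K = E * transpose_mat E"
  have K: "K \<in> carrier_mat (length ?R) (length ?R)"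
    unfolding K_def by (rule mult_carrier_mat[OF E Et])
  have inj_K: "inj_mat K" using inj_gram[OF Et inj_Et] by (simp add: K_def)
  let ?uR = "sub_vec ?u ?R"
  have Fs: "F *\<^sub>v ?sv \<in> carrier_vec n" by (rule mult_mat_vec_carrier[OF F sv])
  note uB = sub_vec_corr_vec[OF ad, of t]
  have K_u: "K *\<^sub>v ?uR = E *\<^sub>v dual_data - t \<cdot>\<^sub>v (E *\<^sub>v (F *\<^sub>v ?sv))"
  proof -
    have SuR: "?S *\<^sub>v ?uR \<in> carrier_vec p" by (rule mult_mat_vec_carrier[OF sel_carrier sub_vec_carrier])
    have SuB: "sel p B *\<^sub>v sub_vec ?u B \<in> carrier_vec p"
      by (rule mult_mat_vec_carrier[OF sel_carrier sub_vec_carrier])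
    have tFs: "t \<cdot>\<^sub>v (F *\<^sub>v ?sv) = transpose_mat ?D *\<^sub>v (sel p B *\<^sub>v sub_vec ?u B)"
    proof -
      have "transpose_mat ?D *\<^sub>v (sel p B *\<^sub>v sub_vec ?u B) = F *\<^sub>v sub_vec ?u B"
        by (rule F_mult[OF sub_vec_carrier, symmetric])
      also have "\<dots> = t \<cdot>\<^sub>v (F *\<^sub>v ?sv)"
        unfolding uB by (rule mult_mat_vec[OF F sv])
      finally show ?thesis ..
    qed
    have "transpose_mat E *\<^sub>v ?uR + t \<cdot>\<^sub>v (F *\<^sub>v ?sv) =
        transpose_mat ?D *\<^sub>v (sel p B *\<^sub>v sub_vec ?u B + ?S *\<^sub>v ?uR)"
      unfolding tFs Et_mult[OF sub_vec_carrier] mult_add_distrib_mat_vec[OF Dt SuB SuR]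
      by (rule comm_add_vec[OF mult_mat_vec_carrier[OF Dt SuR] mult_mat_vec_carrier[OF Dt SuB]])
    also have "\<dots> = transpose_mat ?D *\<^sub>v ?u" unfolding sel_split[OF d B u] ..
    finally have sum: "transpose_mat E *\<^sub>v ?uR + t \<cdot>\<^sub>v (F *\<^sub>v ?sv) = transpose_mat ?D *\<^sub>v ?u" .
    have EtuR: "transpose_mat E *\<^sub>v ?uR \<in> carrier_vec n"
      by (rule mult_mat_vec_carrier[OF Et sub_vec_carrier])
    have "K *\<^sub>v ?uR + t \<cdot>\<^sub>v (E *\<^sub>v (F *\<^sub>v ?sv)) =
        E *\<^sub>v (transpose_mat E *\<^sub>v ?uR + t \<cdot>\<^sub>v (F *\<^sub>v ?sv))"
      unfolding K_def assoc_mult_mat_vec[OF E Et sub_vec_carrier]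
        mult_add_distrib_mat_vec[OF E EtuR smult_carrier_vec[THEN iffD2, OF Fs]] mult_mat_vec[OF E Fs] ..
    also have "\<dots> = sub_vec (?D *\<^sub>v (y - X *\<^sub>v ?b)) ?R"
      unfolding sum using E_mult[OF mult_mat_vec_carrier[OF Dt u]] pinv_transpose_mult[OF r] by simp
    also have "?D *\<^sub>v (y - X *\<^sub>v ?b) = ?D *\<^sub>v y - ?b"
      using mult_minus_distrib_mat_vec[OF D y X_mult[OF P(1)]] pinv_mult_X[OF P(1)] by simp
    also have "sub_vec (?D *\<^sub>v y - ?b) ?R = sub_vec (?D *\<^sub>v y) ?R"
    proof (rule eq_vecI)
      fix k assume "k < dim_vec (sub_vec (?D *\<^sub>v y) ?R)"
      hence k: "k < length ?R" by simp
      hence Rk: "?R ! k < p" "?R ! k \<notin> set B"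
        using nth_mem[OF k] remaining_props(1)[of p B] by auto
      show "sub_vec (?D *\<^sub>v y - ?b) ?R $ k = sub_vec (?D *\<^sub>v y) ?R $ k"
        using k Rk P(1)[of t] P(2)[OF Rk, of t] y' by simp
    qed simp
    also have "\<dots> = E *\<^sub>v dual_data"
      unfolding E_mult[OF yt] pinv_mult_X[OF y'] ..
    finally have *: "K *\<^sub>v ?uR + t \<cdot>\<^sub>v (E *\<^sub>v (F *\<^sub>v ?sv)) = E *\<^sub>v dual_data" .
    show ?thesis
    proof (rule eq_vecI)
      fix k assume "k < dim_vec (E *\<^sub>v dual_data - t \<cdot>\<^sub>v (E *\<^sub>v (F *\<^sub>v ?sv)))"
      hence k: "k < length ?R" using E by simp
      have "(K *\<^sub>v ?uR + t \<cdot>\<^sub>v (E *\<^sub>v (F *\<^sub>v ?sv))) $ k = (E *\<^sub>v dual_data) $ k" using * by simp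
      thus "(K *\<^sub>v ?uR) $ k = (E *\<^sub>v dual_data - t \<cdot>\<^sub>v (E *\<^sub>v (F *\<^sub>v ?sv))) $ k"
        using k E K by (simp del: index_mult_mat_vec)
    qed (use E K in simp)
  qed
  note pK = pinv_full_column_rank(1)[OF K inj_K]
  have Ey: "E *\<^sub>v dual_data \<in> carrier_vec (length ?R)" by (rule mult_mat_vec_carrier[OF E yt])
  have EFs: "E *\<^sub>v (F *\<^sub>v ?sv) \<in> carrier_vec (length ?R)" by (rule mult_mat_vec_carrier[OF E Fs])
  have a: "dual_a dual_data ?D B = pinv K *\<^sub>v (E *\<^sub>v dual_data)"
    by (simp add: dual_a_def Let_def K_def E_def)
  have b: "dual_b ?D B s = pinv K *\<^sub>v (E *\<^sub>v (F *\<^sub>v ?sv))"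
    by (simp add: dual_b_def Let_def K_def E_def F_def)
  have "?uR = pinv K *\<^sub>v (K *\<^sub>v ?uR)" by (rule pinv_mult_vec[OF K inj_K sub_vec_carrier, symmetric])
  also have "\<dots> = dual_a dual_data ?D B - t \<cdot>\<^sub>v dual_b ?D B s"
    unfolding K_u a b mult_minus_distrib_mat_vec[OF pK Ey smult_carrier_vec[THEN iffD2, OF EFs]]
      mult_mat_vec[OF pK EFs] ..
  finally show "?uR = dual_a dual_data ?D B - t \<cdot>\<^sub>v dual_b ?D B s" .
qed

lemma dual_line_index:
  assumes ad: "admissible B s" and m: "m < length (remaining p B)"
  shows "dual_a dual_data (pinv X) B $ m - t * dual_b (pinv X) B s $ m =
    corr (point B s t) (remaining p B ! m)"
proof -
  let ?R = "remaining p B" and ?v = "dual_a dual_data (pinv X) B - t \<cdot>\<^sub>v dual_b (pinv X) B s"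
  have R: "?R ! m < p" using m remaining_props(3) nth_mem by blast
  have "?v $ m = corr (point B s t) (?R ! m)"
    unfolding dual_line[OF ad, of t, symmetric]
    using m corr_vec_index[OF R] by (simp del: index_mult_mat_vec)
  moreover have "dim_vec ?v = length ?R"
    unfolding dual_line[OF ad, of t, symmetric] by simp
  ultimately show ?thesis using m by simp
qed

end

section \<open>Hitting times\<close>

text \<open>
  At the start no variable has been fixed, so \<open>b = 0\<close> and only \<open>a = \<plusminus>t\<close> has to be solved; this is the
  one case without an upper bound for the hitting time.
\<close>
lemma hitting_time_infinity: "hitting_time \<infinity> a 0 = \<bar>a\<bar>"
  unfolding hitting_time_def by (rule Greatest_equality) auto

text \<open>
  The function \<open>t - \<bar>a - t b\<bar>\<close> is at most \<open>0\<close> at \<open>0\<close> and at least \<open>0\<close> at \<open>l\<close>.  Its zeros in \<open>[0, l]\<close> therefore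
  form a nonempty compact set, whose maximum is the hitting time, and beyond this maximum a
  value \<open>\<le> 0\<close> would force a further zero.
\<close>
lemma hitting_time_finite:
  fixes a b l :: real
  assumes l: "\<bar>a - l * b\<bar> \<le> l"
  defines "h \<equiv> hitting_time (ereal l) a b"
  shows "0 \<le> h" "h \<le> l" "\<bar>a - h * b\<bar> = h" "\<And>t. h < t \<Longrightarrow> t \<le> l \<Longrightarrow> \<bar>a - t * b\<bar> < t"
proof -
  let ?S = "{0..l} \<inter> {t. \<bar>a - t * b\<bar> = t}"
  have IVT: "\<exists>t'. t \<le> t' \<and> t' \<in> ?S" if "0 \<le> t" "t \<le> l" "t \<le> \<bar>a - t * b\<bar>" for t
  proof -
    have "\<exists>t'\<ge>t. t' \<le> l \<and> t' - \<bar>a - t' * b\<bar> = 0"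
      using that l by (intro IVT') (auto intro!: continuous_intros)
    thus ?thesis using that(1) by fastforce
  qed
  have "closed {t. \<bar>a - t * b\<bar> = t}"
    by (intro closed_Collect_eq continuous_intros)
  hence "compact ?S" by (intro compact_Int_closed compact_Icc)
  moreover have "?S \<noteq> {}" using IVT[of 0] l by fastforce
  ultimately obtain g where g: "g \<in> ?S" "\<forall>t\<in>?S. t \<le> g"
    using compact_attains_sup by blast
  have "h = g"
    unfolding h_def hitting_time_def
    by (rule Greatest_equality) (use g in \<open>auto simp: abs_if split: if_splits\<close>)
  thus "0 \<le> h" "h \<le> l" "\<bar>a - h * b\<bar> = h" using g(1) by auto
  show "\<bar>a - t * b\<bar> < t" if t: "h < t" "t \<le> l" for t
  proof (rule ccontr)
    assume "\<not> \<bar>a - t * b\<bar> < t"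
    hence "0 \<le> t" "t \<le> \<bar>a - t * b\<bar>" using t(1) \<open>0 \<le> h\<close> by auto
    then obtain t' where "t \<le> t'" "t' \<in> ?S" using IVT t(2) by blast
    moreover from this(2) have "t' \<le> g" using g(2) by blast
    ultimately show False using \<open>h = g\<close> t(1) by simp
  qed
qed

context regression
begin

abbreviation knot :: "ereal \<Rightarrow> nat list \<Rightarrow> real list \<Rightarrow> real" where
  "knot \<equiv> dual_next dual_data (pinv X)"

abbreviation hit :: "ereal \<Rightarrow> nat list \<Rightarrow> real list \<Rightarrow> nat \<Rightarrow> real" where
  "hit \<equiv> dual_hit dual_data (pinv X)"

definition tied :: "nat list \<Rightarrow> real list \<Rightarrow> real \<Rightarrow> nat set" where
  "tied B s t = {j. j < p \<and> j \<notin> set B \<and> \<bar>corr (point B s t) j\<bar> = t}"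

text \<open>
  The invariant of the dual path algorithm.  The bound on all correlations is what makes hitting
  times exist.  Signs are nonzero only before level \<open>0\<close>: a variable that enters at \<open>0\<close> gets the sign \<open>0\<close>,
  but then the algorithm stops.
\<close>
definition valid :: "ereal \<Rightarrow> nat list \<Rightarrow> real list \<Rightarrow> bool" where
  "valid L B s \<longleftrightarrow> admissible B s \<and> (0 < L \<longrightarrow> (\<forall>k < length s. \<bar>s ! k\<bar> = 1)) \<and>
     (L = \<infinity> \<and> B = [] \<or>
      (\<exists>l. L = ereal l \<and> B \<noteq> [] \<and> (\<forall>j<p. \<bar>corr (point B s l) j\<bar> \<le> l)))"

lemma valid_admissible: "valid L B s \<Longrightarrow> admissible B s"
  by (simp add: valid_def)

lemma point_Nil: "point [] [] t = 0\<^sub>v p"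
  by (rule equicorrelated_unique[symmetric]) (auto simp: admissible_def)

lemma corr_zero: "corr (0\<^sub>v p) j = col X j \<bullet> y"
proof -
  have "X *\<^sub>v 0\<^sub>v p = 0\<^sub>v n" by (rule eq_vecI) (auto simp: scalar_prod_def)
  thus ?thesis using y by (simp add: correlation_def)
qed

text \<open>
  With an empty boundary list the equicorrelated point is \<open>0\<close> at every level, so the dual lines are
  constant.
\<close>
lemma dual_b_Nil:
  assumes m: "m < length (remaining p [])"
  shows "dual_b (pinv X) [] [] $ m = 0"
proof -
  have ad: "admissible [] []" by (simp add: admissible_def)
  show ?thesis
    using dual_line_index[OF ad m, of 0] dual_line_index[OF ad m, of 1] by (simp add: point_Nil)
qed

lemma hit:
  assumes v: "valid L B s" and L: "0 < L" and m: "m < length (remaining p B)"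
  defines "h \<equiv> hit L B s m" and "c \<equiv> \<lambda>t. \<bar>corr (point B s t) (remaining p B ! m)\<bar>"
  shows "0 \<le> h" "ereal h \<le> L" "c h = h" "\<And>t. h < t \<Longrightarrow> ereal t \<le> L \<Longrightarrow> c t < t"
proof -
  note ad = valid_admissible[OF v]
  define a where "a = dual_a dual_data (pinv X) B $ m"
  define b where "b = dual_b (pinv X) B s $ m"
  have c: "c t = \<bar>a - t * b\<bar>" for t
    unfolding c_def a_def b_def dual_line_index[OF ad m] ..
  have h: "h = hitting_time L a b" by (simp add: h_def dual_hit_def a_def b_def)
  have R: "remaining p B ! m < p" using m remaining_props(3) nth_mem by blast
  consider "L = \<infinity>" "B = []" | l where "L = ereal l" "\<forall>j<p. \<bar>corr (point B s l) j\<bar> \<le> l"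
    using v by (auto simp: valid_def)
  hence "0 \<le> h \<and> ereal h \<le> L \<and> c h = h \<and> (\<forall>t. h < t \<longrightarrow> ereal t \<le> L \<longrightarrow> c t < t)"
  proof cases
    case 1
    hence "s = []" using ad by (simp add: admissible_def)
    hence b: "b = 0" using dual_b_Nil m 1 by (simp add: b_def)
    hence "h = \<bar>a\<bar>" using hitting_time_infinity 1 h by simp
    thus ?thesis
      using 1 by (simp add: c b)
  next
    case (2 l)
    hence "c l \<le> l" using R by (simp add: c_def)
    thus ?thesis
      using hitting_time_finite[of a l b] 2 h by (simp add: c)
  qed
  thus "0 \<le> h" "ereal h \<le> L" "c h = h" "\<And>t. h < t \<Longrightarrow> ereal t \<le> L \<Longrightarrow> c t < t"
    by blast+
qed

section \<open>Knots and the ends of LARS steps\<close>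

lemma knot_eq: "knot L B s =
    (if remaining p B = [] then 0 else Max (hit L B s ` {..<length (remaining p B)}))"
  by (simp add: dual_next_def Let_def)

lemma hit_le_knot: "m < length (remaining p B) \<Longrightarrow> hit L B s m \<le> knot L B s"
  unfolding knot_eq by auto

lemma knot_attained:
  assumes "remaining p B \<noteq> []"
  obtains m where "m < length (remaining p B)" "hit L B s m = knot L B s"
proof -
  have "knot L B s \<in> hit L B s ` {..<length (remaining p B)}"
    unfolding knot_eq using assms by (auto intro!: Max_in)
  thus ?thesis using that by auto
qed

lemma remaining_index:
  assumes "j < p" "j \<notin> set B"
  obtains m where "m < length (remaining p B)" "remaining p B ! m = j"
  using assms remaining_props(1)[of p B] by (metis (mono_tags, lifting) in_set_conv_nth mem_Collect_eq)

lemma remaining_nth: "m < length (remaining p B) \<Longrightarrow> remaining p B ! m < p \<and> remaining p B ! m \<notin> set B"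
  using nth_mem[of m "remaining p B"] remaining_props(1)[of p B] by auto

text \<open>
  The knot is the largest hitting time, so the properties of single hitting times carry over to all
  inactive variables at once.
\<close>
lemma knot:
  assumes v: "valid L B s" and L: "0 < L"
  defines "K \<equiv> knot L B s"
  shows knot_nonneg: "0 \<le> K" and knot_le: "ereal K \<le> L"
    and before_knot: "\<And>t j. K < t \<Longrightarrow> ereal t \<le> L \<Longrightarrow> j < p \<Longrightarrow> j \<notin> set B \<Longrightarrow>
      \<bar>corr (point B s t) j\<bar> < t"
    and at_knot: "\<And>j. j < p \<Longrightarrow> j \<notin> set B \<Longrightarrow> \<bar>corr (point B s K) j\<bar> \<le> K"
    and tied_at_knot: "{remaining p B ! m | m. m < length (remaining p B) \<and> hit L B s m = K} =
      tied B s K"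
    and tied_nonempty: "remaining p B \<noteq> [] \<or> 0 < K \<Longrightarrow> tied B s K \<noteq> {}"
proof -
  let ?R = "remaining p B"
  note H = hit[OF v L]
  have "0 \<le> K \<and> ereal K \<le> L"
  proof (cases "?R = []")
    case True
    thus ?thesis using L unfolding K_def knot_eq by (simp add: zero_ereal_def less_imp_le)
  next
    case False
    thus ?thesis using knot_attained[OF False, of L s] H(1,2) unfolding K_def by metis
  qed
  thus K0: "0 \<le> K" and KL: "ereal K \<le> L" by auto
  show "\<bar>corr (point B s t) j\<bar> < t" if t: "K < t" "ereal t \<le> L" and j: "j < p" "j \<notin> set B" for t j
  proof -
    obtain m where m: "m < length ?R" "?R ! m = j" using remaining_index[OF j] .
    have "hit L B s m < t" using hit_le_knot[OF m(1), of L s] t(1) unfolding K_def by simp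
    thus ?thesis using H(4)[OF m(1) _ t(2)] m(2) by simp
  qed
  have hit_less: "\<bar>corr (point B s K) (?R ! m)\<bar> < K" if "m < length ?R" "hit L B s m \<noteq> K" for m
    using hit_le_knot[OF that(1), of L s] that(2) H(4)[OF that(1) _ KL] unfolding K_def by fastforce
  have hit_eq: "\<bar>corr (point B s K) (?R ! m)\<bar> = K" if "m < length ?R" "hit L B s m = K" for m
    using H(3)[OF that(1)] that(2) by simp
  show "\<bar>corr (point B s K) j\<bar> \<le> K" if j: "j < p" "j \<notin> set B" for j
  proof -
    obtain m where m: "m < length ?R" "?R ! m = j" using remaining_index[OF j] .
    show ?thesis using hit_less[OF m(1)] hit_eq[OF m(1)] m(2) by fastforce
  qed
  show tie: "{?R ! m | m. m < length ?R \<and> hit L B s m = K} = tied B s K"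
  proof (intro subset_antisym subsetI)
    fix j assume "j \<in> {?R ! m | m. m < length ?R \<and> hit L B s m = K}"
    then obtain m where "m < length ?R" "hit L B s m = K" "j = ?R ! m" by blast
    thus "j \<in> tied B s K" using hit_eq remaining_nth unfolding tied_def by blast
  next
    fix j assume j: "j \<in> tied B s K"
    then obtain m where m: "m < length ?R" "?R ! m = j"
      using remaining_index[of j B] unfolding tied_def by blast
    have "hit L B s m = K" using hit_less[OF m(1)] j m(2) unfolding tied_def by fastforce
    thus "j \<in> {?R ! m | m. m < length ?R \<and> hit L B s m = K}" using m by blast
  qed
  assume "?R \<noteq> [] \<or> 0 < K"
  hence "?R \<noteq> []" unfolding K_def knot_eq by auto
  then obtain m where "m < length ?R" "hit L B s m = K" using knot_attained unfolding K_def by blast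
  thus "tied B s K \<noteq> {}" unfolding tie[symmetric] by blast
qed

text \<open>
  At a level \<open>t\<close> where \<open>j\<close> ties, its correlation is \<open>t\<close> times its own sign; so the point of the old
  curve meets the conditions that define the point of the new one.
\<close>
lemma point_extend:
  assumes ad: "admissible B s" and j: "j \<in> tied B s t"
  defines "c \<equiv> sgn (corr (point B s t) j)"
  shows "admissible (B @ [j]) (s @ [c])" "point (B @ [j]) (s @ [c]) t = point B s t"
proof -
  have jp: "j < p" "j \<notin> set B" and cj: "\<bar>corr (point B s t) j\<bar> = t" using j by (auto simp: tied_def)
  show ad': "admissible (B @ [j]) (s @ [c])" using ad jp by (auto simp: admissible_def)
  note P = equicorrelated[OF ad, where t = t]
  have tc: "corr (point B s t) j = t * c"
    unfolding c_def using abs_mult_sgn[of "corr (point B s t) j"] cj by simp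
  have l: "length s = length B" using ad by (simp add: admissible_def)
  show "point (B @ [j]) (s @ [c]) t = point B s t"
  proof (rule equicorrelated_unique[OF ad' P(1), symmetric])
    show "point B s t $ i = 0" if "i < p" "i \<notin> set (B @ [j])" for i using P(2) that by simp
    show "corr (point B s t) ((B @ [j]) ! k) = t * (s @ [c]) ! k" if "k < length (B @ [j])" for k
    proof (cases "k < length B")
      case True
      thus ?thesis using P(3)[OF True] l by (simp add: nth_append)
    next
      case False
      hence "k = length B" using that by simp
      thus ?thesis using tc l by (simp add: nth_append)
    qed
  qed
qed

lemma abs_corr_point:
  assumes v: "valid L B s" and L: "0 < L" and k: "k < length B"
  shows "\<bar>corr (point B s t) (B ! k)\<bar> = \<bar>t\<bar>"
proof -
  have "\<bar>s ! k\<bar> = 1" using v L k by (simp add: valid_def admissible_def)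
  thus ?thesis using equicorrelated(3)[OF valid_admissible[OF v] k, of t] by (simp add: abs_mult)
qed

lemma valid_extend:
  assumes v: "valid L B s" and L: "0 < L"
  defines "K \<equiv> knot L B s"
  assumes j: "j \<in> tied B s K"
  shows "valid (ereal K) (B @ [j]) (s @ [sgn (corr (point B s K) j)])"
proof -
  note E = point_extend[OF valid_admissible[OF v] j]
  note K0 = knot_nonneg[OF v L, folded K_def]
  have l: "length s = length B" using v by (simp add: valid_def admissible_def)
  have "\<bar>(s @ [sgn (corr (point B s K) j)]) ! k\<bar> = 1"
    if "0 < ereal K" "k < length (s @ [sgn (corr (point B s K) j)])" for k
  proof (cases "k < length s")
    case True
    thus ?thesis using v L by (simp add: valid_def nth_append)
  next
    case False
    hence k: "k = length s" using that by simp
    have "corr (point B s K) j \<noteq> 0" using j that(1) by (auto simp: tied_def)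
    thus ?thesis using k by (simp add: abs_sgn_eq)
  qed
  moreover have "\<bar>corr (point B s K) i\<bar> \<le> K" if i: "i < p" for i
  proof (cases "i \<in> set B")
    case True
    then obtain k where "k < length B" "i = B ! k" by (auto simp: in_set_conv_nth)
    thus ?thesis using abs_corr_point[OF v L] K0 by simp
  next
    case False
    thus ?thesis using at_knot[OF v L i, folded K_def] by simp
  qed
  ultimately show ?thesis
    using E by (simp add: valid_def)
qed

lemma active_level_point:
  assumes v: "valid L B s" and L: "0 < L" and B: "B \<noteq> []"
  shows "active_level X y B (point B s t) = \<bar>t\<bar>"
proof -
  have "(\<lambda>j. \<bar>corr (point B s t) j\<bar>) ` set B = {\<bar>t\<bar>}"
  proof -
    have "\<bar>corr (point B s t) j\<bar> = \<bar>t\<bar>" if "j \<in> set B" for j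
      using abs_corr_point[OF v L] that by (auto simp: in_set_conv_nth)
    moreover obtain j where "j \<in> set B" using B by (cases B) auto
    ultimately show ?thesis by force
  qed
  thus ?thesis by (simp add: active_level_def)
qed

lemma tied_inactive_point:
  assumes "valid L B s" "0 < L" "B \<noteq> []" "0 \<le> t"
  shows "tied_inactive X y B (point B s t) = tied B s t"
  using assms(4) unfolding tied_inactive_def tied_def active_level_point[OF assms(1-3)] by simp

text \<open>
  Between \<open>l\<close> and the knot no variable ties and the level is positive, so LARS does not stop
  earlier; at the knot either a variable ties or no variable remains and the level is \<open>0\<close>.
\<close>
lemma lars_step_point:
  assumes v: "valid (ereal l) B s" and L: "0 < l" and B: "B \<noteq> []"
  shows "lars_step X y B s (point B s l) = l - knot (ereal l) B s"
proof -
  let ?K = "knot (ereal l) B s"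
  have L': "0 < ereal l" using L by simp
  note ad = valid_admissible[OF v]
  note N = knot_nonneg[OF v L'] knot_le[OF v L', simplified]
  note move = lars_move_equicorrelated[OF ad]
  note lev = active_level_point[OF v L' B]
  show ?thesis
    unfolding lars_step_def
  proof (rule Least_equality)
    have "tied B s ?K \<noteq> {} \<or> ?K = 0" using tied_nonempty[OF v L'] N by linarith
    hence "tied_inactive X y B (point B s ?K) \<noteq> {} \<or> active_level X y B (point B s ?K) = 0"
      using tied_inactive_point[OF v L' B N(1)] lev by simp
    thus "0 \<le> l - ?K \<and>
      (tied_inactive X y B (lars_move X B s (point B s l) (l - ?K)) \<noteq> {} \<or>
       active_level X y B (lars_move X B s (point B s l) (l - ?K)) = 0)"
      using N(2) unfolding move by simp
  next
    fix g assume "0 \<le> g \<and>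
      (tied_inactive X y B (lars_move X B s (point B s l) g) \<noteq> {} \<or>
       active_level X y B (lars_move X B s (point B s l) g) = 0)"
    hence g: "0 \<le> g" and *: "tied_inactive X y B (point B s (l - g)) \<noteq> {} \<or>
        active_level X y B (point B s (l - g)) = 0"
      unfolding move by auto
    show "l - ?K \<le> g"
    proof (rule ccontr)
      assume "\<not> l - ?K \<le> g"
      hence t: "?K < l - g" "ereal (l - g) \<le> ereal l" "0 \<le> l - g" using g N(1) by auto
      have "tied B s (l - g) = {}" using before_knot[OF v L' t(1,2)] unfolding tied_def by fastforce
      moreover have "active_level X y B (point B s (l - g)) \<noteq> 0" using lev t(1) N(1) by simp
      ultimately show False using * tied_inactive_point[OF v L' B t(3)] by simp
    qed
  qed
qed

end

section \<open>Stages of the dual path algorithm\<close>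

locale tie_broken_regression = regression +
  fixes tie :: "nat list \<Rightarrow> nat set \<Rightarrow> nat"
  assumes tie: "S \<noteq> {} \<Longrightarrow> tie A S \<in> S"
begin

abbreviation dstate :: "ereal \<Rightarrow> nat list \<Rightarrow> real list \<Rightarrow> bool" where
  "dstate \<equiv> dual_state dual_data (pinv X) tie"

definition entering :: "ereal \<Rightarrow> nat list \<Rightarrow> real list \<Rightarrow> nat" where
  "entering L B s = tie B (tied B s (knot L B s))"

definition entering_sign :: "ereal \<Rightarrow> nat list \<Rightarrow> real list \<Rightarrow> real" where
  "entering_sign L B s = sgn (corr (point B s (knot L B s)) (entering L B s))"

lemma entering_tied: "tied B s (knot L B s) \<noteq> {} \<Longrightarrow> entering L B s \<in> tied B s (knot L B s)"
  unfolding entering_def by (rule tie)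

text \<open>
  The indexing of \<open>a\<close> and \<open>b\<close> by positions among the remaining coordinates is confined to this lemma:
  it expresses an iteration through the tied variables of the curve.
\<close>
lemma dual_step_entering:
  assumes v: "valid L B s" and L: "0 < L" and R: "R = remaining (dim_row (pinv X)) B"
    and K: "K = knot L B s" and m: "m < length R"
    and t: "R ! m = tie B {R ! l | l. l < length R \<and> hit L B s l = K}"
  shows "tied B s K \<noteq> {}" "R ! m = entering L B s"
    "sgn (dual_a dual_data (pinv X) B $ m - K * dual_b (pinv X) B s $ m) = entering_sign L B s"
proof -
  have R': "R = remaining p B" using R by simp
  have m': "m < length (remaining p B)" using m R' by simp
  have "remaining p B \<noteq> []" using m' by auto
  thus "tied B s K \<noteq> {}" unfolding K by (intro tied_nonempty[OF v L]) simp
  show e: "R ! m = entering L B s"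
    using t unfolding R' K tied_at_knot[OF v L] entering_def .
  show "sgn (dual_a dual_data (pinv X) B $ m - K * dual_b (pinv X) B s $ m) = entering_sign L B s"
    unfolding dual_line_index[OF valid_admissible[OF v] m'] entering_sign_def
    using e by (simp only: R' K)
qed

lemma dstate_valid: "dstate L B s \<Longrightarrow> valid L B s"
proof (induction rule: dual_state.induct)
  case start
  show ?case by (simp add: valid_def admissible_def)
next
  case (step L B s R K m)
  note S = dual_step_entering[OF step.IH step.hyps(2-6)]
  have "entering L B s \<in> tied B s K" using entering_tied S(1) step.hyps(4) by simp
  thus ?case
    using valid_extend[OF step.IH step.hyps(2)] step.hyps(4)
    unfolding S(2,3) entering_sign_def by simp
qed

lemma dstate_induct [consumes 1, case_names start step]:
  assumes "dstate L B s"
    and "P \<infinity> [] []"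
    and "\<And>L B s. dstate L B s \<Longrightarrow> valid L B s \<Longrightarrow> 0 < L \<Longrightarrow> tied B s (knot L B s) \<noteq> {} \<Longrightarrow> P L B s \<Longrightarrow>
      P (ereal (knot L B s)) (B @ [entering L B s]) (s @ [entering_sign L B s])"
  shows "P L B s"
  using assms(1)
proof (induction rule: dual_state.induct)
  case start
  show ?case by (rule assms(2))
next
  case (step L B s R K m)
  have v: "valid L B s" by (rule dstate_valid[OF step.hyps(1)])
  note S = dual_step_entering[OF v step.hyps(2-6)]
  show ?case
    using assms(3)[OF step.hyps(1) v step.hyps(2) _ step.IH] S(1) step.hyps(4)
    unfolding S(2,3) by simp
qed

lemma dstate_step:
  assumes d: "dstate L B s" and L: "0 < L" and ne: "tied B s (knot L B s) \<noteq> {}"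
  shows "dstate (ereal (knot L B s)) (B @ [entering L B s]) (s @ [entering_sign L B s])"
proof -
  let ?R = "remaining p B"
  have v: "valid L B s" by (rule dstate_valid[OF d])
  have "entering L B s < p" "entering L B s \<notin> set B"
    using entering_tied[OF ne] by (auto simp: tied_def)
  then obtain m where m: "m < length ?R" "?R ! m = entering L B s" using remaining_index by blast
  have R: "?R = remaining (dim_row (pinv X)) B" by simp
  have t: "?R ! m = tie B {?R ! l | l. l < length ?R \<and> hit L B s l = knot L B s}"
    unfolding m(2) tied_at_knot[OF v L] entering_def ..
  have "entering_sign L B s =
      sgn (dual_a dual_data (pinv X) B $ m - knot L B s * dual_b (pinv X) B s $ m)"
    using dual_step_entering(3)[OF v L R refl m(1) t] by simp
  thus ?thesis using dual_state.step[OF d L R refl m(1) t] m(2) by simp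
qed

lemma dstate_last:
  assumes "dstate L B s" "B \<noteq> []"
  obtains L1 B1 s1 where "dstate L1 B1 s1" "L = ereal (knot L1 B1 s1)"
    "B = B1 @ [entering L1 B1 s1]" "s = s1 @ [entering_sign L1 B1 s1]"
  using assms by (induction rule: dstate_induct) auto

text \<open>
  The number of variables that have entered identifies the stage, since each stage has at most one
  successor.
\<close>
lemma dstate_deterministic:
  assumes "dstate L B s" "dstate L' B' s'" "length B = length B'"
  shows "L = L' \<and> B = B' \<and> s = s'"
  using assms
proof (induction arbitrary: L' B' s' rule: dstate_induct)
  case start
  hence "B' = []" by simp
  with start(1) show ?case by (cases rule: dual_state.cases) auto
next
  case (step L B s)
  have "B' \<noteq> []" using step.prems(2) by auto
  from dstate_last[OF step.prems(1) this] obtain L1 B1 s1 where 1: "dstate L1 B1 s1"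
    "L' = ereal (knot L1 B1 s1)" "B' = B1 @ [entering L1 B1 s1]" "s' = s1 @ [entering_sign L1 B1 s1]" .
  have "L = L1 \<and> B = B1 \<and> s = s1" using step.IH[OF 1(1)] step.prems(2) 1(3) by simp
  thus ?case using 1 by simp
qed

section \<open>The common path\<close>

text \<open>
  The points of the equicorrelated curves on the segments between consecutive knots: the common
  description of the two paths.
\<close>
definition on_common_path :: "real \<Rightarrow> real vec \<Rightarrow> bool" where
  "on_common_path lam b \<longleftrightarrow> (\<exists>L B s. dstate L B s \<and> 0 < L \<and> knot L B s \<le> lam \<and> ereal lam \<le> L \<and>
     b = point B s lam)"

text \<open>
  If the current segment ends above \<open>lam\<close> then its knot is positive, so a variable is left to enter, and
  the next stage begins above \<open>lam\<close>.  This happens at most \<open>p\<close> times.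
\<close>
lemma on_common_path_exists:
  assumes "0 \<le> lam"
  shows "\<exists>b. on_common_path lam b"
proof -
  have "dstate L B s \<Longrightarrow> 0 < L \<Longrightarrow> ereal lam \<le> L \<Longrightarrow> \<exists>b. on_common_path lam b" for L B s
  proof (induction "p - length B" arbitrary: L B s rule: less_induct)
    case less
    have v: "valid L B s" by (rule dstate_valid[OF less.prems(1)])
    show ?case
    proof (cases "knot L B s \<le> lam")
      case True
      thus ?thesis using less.prems unfolding on_common_path_def by blast
    next
      case False
      hence K: "0 < knot L B s" "lam \<le> knot L B s" using assms by auto
      hence ne: "tied B s (knot L B s) \<noteq> {}" using tied_nonempty[OF v less.prems(2)] by blast
      note d = dstate_step[OF less.prems(1,2) ne]
      have "distinct (B @ [entering L B s])" "set (B @ [entering L B s]) \<subseteq> {..<p}"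
        using valid_admissible[OF dstate_valid[OF d]] unfolding admissible_def by blast+
      hence "length (B @ [entering L B s]) \<le> p"
        by (metis card_lessThan card_mono distinct_card finite_lessThan)
      thus ?thesis using less.hyps[OF _ d] K by simp
    qed
  qed
  from this[OF dual_state.start] show ?thesis by simp
qed

lemma entering_point:
  assumes v: "valid L B s" and ne: "tied B s (knot L B s) \<noteq> {}"
  shows "point (B @ [entering L B s]) (s @ [entering_sign L B s]) (knot L B s) =
    point B s (knot L B s)"
  using point_extend(2)[OF valid_admissible[OF v] entering_tied[OF ne]]
  unfolding entering_sign_def .

text \<open>
  If \<open>lam\<close> lies on the segment of a stage and at or below the start of a later stage, then the knots
  between them, which decrease, all equal \<open>lam\<close>.  Adjacent curves meet at their common knot, so the point
  does not change.  The second conjunct records this bound for the induction.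
\<close>
lemma on_common_path_agree:
  assumes "dstate L' B' s'" "dstate L B s" "0 < L" "knot L B s \<le> lam" "ereal lam \<le> L'"
    "length B \<le> length B'"
  shows "point B s lam = point B' s' lam \<and> (length B < length B' \<longrightarrow> L' \<le> ereal lam)"
  using assms
proof (induction rule: dstate_induct)
  case start
  hence "B = []" "s = []" using dstate_valid[OF start(1)] by (auto simp: valid_def admissible_def)
  thus ?case by simp
next
  case (step L1 B1 s1)
  let ?K = "knot L1 B1 s1" and ?j = "entering L1 B1 s1" and ?c = "entering_sign L1 B1 s1"
  show ?case
  proof (cases "length B = length (B1 @ [?j])")
    case True
    have "B = B1 @ [?j] \<and> s = s1 @ [?c]"
      using dstate_deterministic[OF step.prems(1) dstate_step[OF step.hyps(1,3,4)] True] by blast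
    thus ?thesis by simp
  next
    case False
    hence len: "length B \<le> length B1" using step.prems(5) by simp
    have KL: "ereal ?K \<le> L1" by (rule knot_le[OF step.hyps(2,3)])
    hence "ereal lam \<le> L1" using step.prems(4) order_trans by blast
    hence IH: "point B s lam = point B1 s1 lam" "length B < length B1 \<longrightarrow> L1 \<le> ereal lam"
      using step.IH[OF step.prems(1-3) _ len] by blast+
    \<comment> \<open>either this knot ends the segment that contains \<open>lam\<close>, or it is at most \<open>L1\<close>, hence at most \<open>lam\<close>\<close>
    have "?K \<le> lam"
    proof (cases "length B = length B1")
      case True
      hence "L = L1 \<and> B = B1 \<and> s = s1" by (rule dstate_deterministic[OF step.prems(1) step.hyps(1)])
      thus ?thesis using step.prems(3) by simp
    next
      case False
      hence "L1 \<le> ereal lam" using IH(2) len by simp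
      hence "ereal ?K \<le> ereal lam" using KL order_trans by blast
      thus ?thesis by simp
    qed
    hence lam: "lam = ?K" using step.prems(4) by simp
    thus ?thesis using IH(1) entering_point[OF step.hyps(2,4)] by simp
  qed
qed

lemma on_common_path_unique:
  assumes "on_common_path lam b" "on_common_path lam b'"
  shows "b = b'"
proof -
  obtain L B s where 1: "dstate L B s" "0 < L" "knot L B s \<le> lam" "ereal lam \<le> L" "b = point B s lam"
    using assms(1) unfolding on_common_path_def by blast
  obtain L' B' s' where 2: "dstate L' B' s'" "0 < L'" "knot L' B' s' \<le> lam" "ereal lam \<le> L'"
      "b' = point B' s' lam"
    using assms(2) unfolding on_common_path_def by blast
  show ?thesis
  proof (cases "length B \<le> length B'")
    case True
    thus ?thesis using on_common_path_agree[OF 2(1) 1(1-3) 2(4)] 1(5) 2(5) by simp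
  next
    case False
    thus ?thesis using on_common_path_agree[OF 1(1) 2(1-3) 1(4)] 1(5) 2(5) by simp
  qed
qed

text \<open>
  The two subvector equations prescribe \<open>u\<close> on the boundary and off it, and the correlation vector
  of the equicorrelated point satisfies both.
\<close>
lemma on_dual_path_iff:
  "on_dual_path dual_data (pinv X) tie lam u \<longleftrightarrow> (\<exists>b. on_common_path lam b \<and> u = corr_vec b)"
proof
  assume "on_dual_path dual_data (pinv X) tie lam u"
  then obtain L B s where d: "dstate L B s" "0 < L" "knot L B s \<le> lam" "ereal lam \<le> L"
    and u: "u \<in> carrier_vec p" "sub_vec u B = lam \<cdot>\<^sub>v vec_of_list s"
      "sub_vec u (remaining p B) = dual_a dual_data (pinv X) B - lam \<cdot>\<^sub>v dual_b (pinv X) B s"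
    unfolding on_dual_path_def dim_pinv_X by blast
  have ad: "admissible B s" by (rule valid_admissible[OF dstate_valid[OF d(1)]])
  hence dB: "distinct B" "set B \<subseteq> {..<p}" by (auto simp: admissible_def)
  have "y - X *\<^sub>v point B s lam \<in> carrier_vec n" using y equicorrelated(1)[OF ad] by simp
  hence c: "corr_vec (point B s lam) \<in> carrier_vec p" by (rule Xt_mult)
  have "u = corr_vec (point B s lam)"
    using sel_split[OF dB u(1)] sel_split[OF dB c]
    unfolding u(2,3) sub_vec_corr_vec[OF ad] dual_line[OF ad] by metis
  thus "\<exists>b. on_common_path lam b \<and> u = corr_vec b" using d unfolding on_common_path_def by blast
next
  assume "\<exists>b. on_common_path lam b \<and> u = corr_vec b"
  then obtain L B s where d: "dstate L B s" "0 < L" "knot L B s \<le> lam" "ereal lam \<le> L"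
    and u: "u = corr_vec (point B s lam)"
    unfolding on_common_path_def by blast
  have ad: "admissible B s" by (rule valid_admissible[OF dstate_valid[OF d(1)]])
  have "y - X *\<^sub>v point B s lam \<in> carrier_vec n" using y equicorrelated(1)[OF ad] by simp
  hence "u \<in> carrier_vec p" unfolding u by (rule Xt_mult)
  thus "on_dual_path dual_data (pinv X) tie lam u"
    unfolding on_dual_path_def dim_pinv_X
    using d sub_vec_corr_vec[OF ad, of lam] dual_line[OF ad, of lam] unfolding u by blast
qed

text \<open>
  \<open>X\<^sup>T y\<close> minus the correlation vector of \<open>b\<close> is \<open>X\<^sup>T X b\<close>.
\<close>
lemma primal_path_eq:
  assumes "on_common_path lam b"
  shows "primal_path X y (dual_path dual_data (pinv X) tie) lam = b"
proof -
  have "dual_path dual_data (pinv X) tie lam = corr_vec b"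
    unfolding dual_path_def on_dual_path_iff
    using assms on_common_path_unique by (intro the_equality) blast+
  moreover have "mat_inv (Xt * X) *\<^sub>v (Xt *\<^sub>v y - corr_vec b) = b"
  proof -
    have b: "b \<in> carrier_vec p"
      using assms dstate_valid valid_admissible equicorrelated(1) unfolding on_common_path_def by blast
    have Xb: "X *\<^sub>v b \<in> carrier_vec n" using b by simp
    have G: "Xt * X \<in> carrier_mat p p" by (rule mult_carrier_mat[OF Xt X])
    note M = inj_mat_inverse[OF G inj_gram[OF X inj]]
    have XXb: "Xt *\<^sub>v (X *\<^sub>v b) \<in> carrier_vec p" and Xy: "Xt *\<^sub>v y \<in> carrier_vec p"
      by (rule Xt_mult[OF Xb], rule Xt_mult[OF y])
    have "Xt *\<^sub>v y - corr_vec b = (Xt * X) *\<^sub>v b"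
      unfolding mult_minus_distrib_mat_vec[OF Xt y Xb] assoc_mult_mat_vec[OF Xt X b]
      by (rule eq_vecI) (use XXb Xy in \<open>simp_all del: index_mult_mat_vec\<close>)
    hence "mat_inv (Xt * X) *\<^sub>v (Xt *\<^sub>v y - corr_vec b) = mat_inv (Xt * X) *\<^sub>v ((Xt * X) *\<^sub>v b)"
      by (rule arg_cong)
    also have "\<dots> = (mat_inv (Xt * X) * (Xt * X)) *\<^sub>v b"
      by (rule assoc_mult_mat_vec[OF M(1) G b, symmetric])
    also have "\<dots> = b" unfolding M(2) using b by simp
    finally show ?thesis .
  qed
  ultimately show ?thesis by (simp only: primal_path_def)
qed

section \<open>Correspondence with the stages of LARS\<close>

lemma valid_start: "valid \<infinity> [] []"
  by (simp add: valid_def admissible_def)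

text \<open>
  The first knot is the maximal absolute correlation at \<open>b = 0\<close>, so both procedures offer the same
  candidates to the tie-breaking rule.
\<close>
lemma start_maximizers:
  assumes "0 < p"
  shows "tied [] [] (knot \<infinity> [] []) =
    {j. j < dim_col X \<and> (\<forall>i < dim_col X. \<bar>corr (0\<^sub>v p) i\<bar> \<le> \<bar>corr (0\<^sub>v p) j\<bar>)}"
proof -
  have inf: "(0::ereal) < \<infinity>" by simp
  let ?K = "knot \<infinity> [] []"
  have le: "\<bar>corr (0\<^sub>v p) i\<bar> \<le> ?K" if "i < p" for i
    using at_knot[OF valid_start inf that] by (simp add: point_Nil)
  have "remaining p [] \<noteq> []" using assms by (simp add: remaining_def)
  then obtain j0 where "j0 \<in> tied [] [] ?K" using tied_nonempty[OF valid_start inf] by blast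
  hence j0: "j0 < p" "\<bar>corr (0\<^sub>v p) j0\<bar> = ?K" by (auto simp: tied_def point_Nil)
  have "(\<bar>corr (0\<^sub>v p) j\<bar> = ?K) = (\<forall>i < p. \<bar>corr (0\<^sub>v p) i\<bar> \<le> \<bar>corr (0\<^sub>v p) j\<bar>)" if "j < p" for j
    using le[OF that] le j0 by fastforce
  thus ?thesis by (auto simp: tied_def point_Nil)
qed

lemma lars_step_knot:
  assumes v: "valid (ereal l) B s" and l: "0 < l" and B: "B \<noteq> []"
  shows "lars_move X B s (point B s l) (lars_step X y B s (point B s l)) =
    point B s (knot (ereal l) B s)"
  unfolding lars_step_point[OF assms] lars_move_equicorrelated[OF valid_admissible[OF v]] by simp

lemma lars_state_of_dstate:
  assumes "dstate L B s" "0 < L"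
  shows "L = \<infinity> \<and> B = [] \<or> (\<exists>l. L = ereal l \<and> B \<noteq> [] \<and> lars_state X y tie B s (point B s l))"
  using assms
proof (induction rule: dstate_induct)
  case start
  show ?case by simp
next
  case (step L B s)
  let ?K = "knot L B s" and ?j = "entering L B s" and ?c = "entering_sign L B s"
  have K: "0 < ?K" using step.prems by simp
  note ep = entering_point[OF step.hyps(2,4)]
  have "lars_state X y tie (B @ [?j]) (s @ [?c]) (point B s ?K)"
  proof (cases "B = []")
    case True
    hence L: "L = \<infinity>" "s = []" using step.hyps(2) by (auto simp: valid_def admissible_def)
    have p: "0 < p" using entering_tied[OF step.hyps(4)] by (auto simp: tied_def)
    have "?j = tie [] {j. j < dim_col X \<and>
        (\<forall>i < dim_col X. \<bar>corr (0\<^sub>v p) i\<bar> \<le> \<bar>corr (0\<^sub>v p) j\<bar>)}"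
      unfolding start_maximizers[OF p, symmetric] entering_def True L ..
    hence "lars_state X y tie [?j] [sgn (corr (0\<^sub>v p) ?j)] (0\<^sub>v p)"
      using p by (intro lars_state.start) simp_all
    thus ?thesis using True L by (simp add: entering_sign_def point_Nil)
  next
    case False
    then obtain l where l: "L = ereal l" "lars_state X y tie B s (point B s l)"
      using step.IH step.hyps(3) by blast
    have v: "valid (ereal l) B s" and l0: "0 < l" "0 < ereal l" using step.hyps(2,3) l(1) by auto
    let ?b = "point B s ?K"
    have b: "?b = lars_move X B s (point B s l) (lars_step X y B s (point B s l))"
      using lars_step_knot[OF v l0(1) False] l(1) by simp
    have "0 < active_level X y B ?b"
      using active_level_point[OF v l0(2) False] K by simp
    moreover have "?j = tie B (tied_inactive X y B ?b)"
      unfolding entering_def using tied_inactive_point[OF v l0(2) False] K by simp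
    ultimately show ?thesis
      unfolding entering_sign_def by (rule lars_state.step[OF l(2) b])
  qed
  thus ?case using ep by simp
qed

text \<open>
  A column that is not orthogonal to \<open>y\<close> makes the first knot positive, so the first LARS stage is a
  dual stage at a positive level.  Later stages inherit this, since LARS continues only at positive
  levels.
\<close>
lemma dstate_of_lars_state:
  assumes "lars_state X y tie A s b" and nz: "j0 < p" "col X j0 \<bullet> y \<noteq> 0"
  shows "\<exists>l > 0. dstate (ereal l) A s \<and> A \<noteq> [] \<and> b = point A s l"
  using assms(1)
proof (induction rule: lars_state.induct)
  case (start b j)
  let ?K = "knot \<infinity> [] []"
  have inf: "(0::ereal) < \<infinity>" and p: "0 < p" and b: "b = 0\<^sub>v p" using start by auto
  have j: "j = entering \<infinity> [] []"
    using start(3) unfolding b entering_def start_maximizers[OF p] .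
  have "0 < \<bar>corr (point [] [] ?K) j0\<bar>" using nz(2) by (simp add: point_Nil corr_zero)
  also have "\<dots> \<le> ?K" using at_knot[OF valid_start inf nz(1)] by simp
  finally have K: "0 < ?K" .
  have ne: "tied [] [] ?K \<noteq> {}" using tied_nonempty[OF valid_start inf] K by blast
  have c: "sgn (corr b j) = entering_sign \<infinity> [] []"
    by (simp add: entering_sign_def point_Nil j b)
  have "dstate (ereal ?K) [j] [sgn (corr b j)]" "b = point [j] [sgn (corr b j)] ?K"
    using dstate_step[OF dual_state.start inf ne] entering_point[OF valid_start ne]
    unfolding c unfolding j b by (simp_all add: point_Nil)
  thus ?case using K by blast
next
  case (step A s b b' j)
  then obtain l where l: "0 < l" "dstate (ereal l) A s" "A \<noteq> []" "b = point A s l" by blast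
  let ?K = "knot (ereal l) A s"
  have l': "0 < ereal l" using l(1) by simp
  have v: "valid (ereal l) A s" by (rule dstate_valid[OF l(2)])
  have b': "b' = point A s ?K" using step.hyps(2) lars_step_knot[OF v l(1,3)] l(4) by simp
  have K0: "0 \<le> ?K" by (rule knot_nonneg[OF v l'])
  have "0 < \<bar>?K\<bar>" using step.hyps(3) active_level_point[OF v l' l(3)] b' by simp
  hence K: "0 < ?K" using K0 by simp
  have ne: "tied A s ?K \<noteq> {}" using tied_nonempty[OF v l'] K by blast
  have j: "j = entering (ereal l) A s"
    using step.hyps(4) tied_inactive_point[OF v l' l(3) K0] b' by (simp add: entering_def)
  have c: "sgn (corr b' j) = entering_sign (ereal l) A s" by (simp add: entering_sign_def b' j)
  have "dstate (ereal ?K) (A @ [j]) (s @ [sgn (corr b' j)])"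
    "b' = point (A @ [j]) (s @ [sgn (corr b' j)]) ?K"
    using dstate_step[OF l(2) l' ne] entering_point[OF v ne] unfolding c unfolding j b' by simp_all
  thus ?case using K by blast
qed

text \<open>
  If all correlations vanish at \<open>0\<close> then \<open>0\<close> is the equicorrelated point with sign \<open>0\<close> at every level, so
  moving along the curve changes nothing.
\<close>
lemma lars_move_trivial:
  assumes i: "i < p" and z: "\<And>j. j < p \<Longrightarrow> col X j \<bullet> y = 0"
  shows "lars_move X [i] [0] (0\<^sub>v p) g = 0\<^sub>v p"
proof -
  have ad: "admissible [i] [0]" using i by (simp add: admissible_def)
  have "0\<^sub>v p = point [i] [0] t" for t
    by (rule equicorrelated_unique[OF ad]) (use i z in \<open>auto simp: corr_zero\<close>)
  thus ?thesis using lars_move_equicorrelated[OF ad] by metis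
qed

lemma lars_state_trivial:
  assumes "lars_state X y tie A s b" and z: "\<And>j. j < p \<Longrightarrow> col X j \<bullet> y = 0"
  shows "\<exists>j < p. A = [j] \<and> s = [0] \<and> b = 0\<^sub>v p"
  using assms(1)
proof (induction rule: lars_state.induct)
  case (start b j)
  let ?S = "{j. j < dim_col X \<and> (\<forall>i < dim_col X. \<bar>corr b i\<bar> \<le> \<bar>corr b j\<bar>)}"
  have c: "corr b i = 0" if "i < p" for i using start(2) z[OF that] by (simp add: corr_zero)
  hence "0 \<in> ?S" using start(1) by simp
  hence "j \<in> ?S" using tie[of ?S "[]"] start(3) by blast
  hence "j < p" by simp
  thus ?case using c start(2) by simp
next
  case (step A s b b' j)
  then obtain i where i: "i < p" "A = [i]" "s = [0]" "b = 0\<^sub>v p" by blast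
  have "b' = 0\<^sub>v p" using lars_move_trivial[OF i(1) z] step.hyps(2) i by simp
  hence "active_level X y A b' = 0" using i z by (simp add: active_level_def corr_zero)
  thus ?case using step.hyps(3) by simp
qed

lemma on_common_path_zero:
  assumes "\<forall>j < p. \<bar>col X j \<bullet> y\<bar> \<le> lam" "0 \<le> lam"
  shows "on_common_path lam (0\<^sub>v p)"
proof -
  let ?K = "knot \<infinity> [] []"
  have inf: "(0::ereal) < \<infinity>" by simp
  have "?K \<le> lam"
  proof (cases "0 < ?K")
    case True
    then obtain j where "j \<in> tied [] [] ?K" using tied_nonempty[OF valid_start inf] by blast
    thus ?thesis using assms(1) by (auto simp: tied_def point_Nil corr_zero)
  qed (use assms(2) in simp)
  thus ?thesis
    unfolding on_common_path_def using dual_state.start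
    by (intro exI[of _ \<infinity>] exI[of _ "[]"]) (simp add: point_Nil)
qed

lemma on_lars_path_iff:
  assumes lam: "0 \<le> lam"
  shows "on_lars_path X y tie lam b \<longleftrightarrow> on_common_path lam b"
proof
  assume "on_lars_path X y tie lam b"
  then consider "b = 0\<^sub>v p" "\<forall>j < p. \<bar>col X j \<bullet> y\<bar> \<le> lam"
    | A s b0 g where "lars_state X y tie A s b0" "0 \<le> g" "g \<le> lars_step X y A s b0"
        "b = lars_move X A s b0 g" "lam = active_level X y A b"
    unfolding on_lars_path_def dims by blast
  thus "on_common_path lam b"
  proof cases
    case 1
    thus ?thesis using on_common_path_zero lam by simp
  next
    case (2 A s b0 g)
    show ?thesis
    proof (cases "\<exists>j < p. col X j \<bullet> y \<noteq> 0")
      case True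
      then obtain l where l: "0 < l" "dstate (ereal l) A s" "A \<noteq> []" "b0 = point A s l"
        using dstate_of_lars_state[OF 2(1)] by blast
      have l': "0 < ereal l" using l(1) by simp
      have v: "valid (ereal l) A s" by (rule dstate_valid[OF l(2)])
      have g: "g \<le> l - knot (ereal l) A s" using 2(3) lars_step_point[OF v l(1,3)] l(4) by simp
      have b: "b = point A s (l - g)"
        using 2(4) lars_move_equicorrelated[OF valid_admissible[OF v]] l(4) by simp
      have "lam = \<bar>l - g\<bar>" using 2(5) active_level_point[OF v l' l(3)] b by simp
      hence "lam = l - g" using g knot_nonneg[OF v l'] by simp
      thus ?thesis unfolding on_common_path_def using l(2) l' b g 2(2)
        by (intro exI[of _ "ereal l"] exI[of _ A] exI[of _ s]) simp
    next
      case False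
      hence z: "col X j \<bullet> y = 0" if "j < p" for j using that by blast
      obtain j where j: "j < p" "A = [j]" "s = [0]" "b0 = 0\<^sub>v p"
        using lars_state_trivial[OF 2(1) z] by blast
      hence "b = 0\<^sub>v p" using 2(4) lars_move_trivial[OF j(1) z] by simp
      thus ?thesis using on_common_path_zero[OF _ lam] z lam by simp
    qed
  qed
next
  assume "on_common_path lam b"
  then obtain L B s where d: "dstate L B s" "0 < L" "knot L B s \<le> lam" "ereal lam \<le> L"
    "b = point B s lam"
    unfolding on_common_path_def by blast
  have v: "valid L B s" by (rule dstate_valid[OF d(1)])
  consider "L = \<infinity>" "B = []"
    | l where "L = ereal l" "B \<noteq> []" "lars_state X y tie B s (point B s l)"
    using lars_state_of_dstate[OF d(1,2)] by blast
  thus "on_lars_path X y tie lam b"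
  proof cases
    case 1
    hence s: "s = []" using v by (simp add: valid_def admissible_def)
    have "\<bar>col X j \<bullet> y\<bar> \<le> lam" if "j < p" for j
      using at_knot[OF v d(2) that] 1 s d(3) by (simp add: point_Nil corr_zero)
    thus ?thesis using d(5) 1 s by (simp add: on_lars_path_def point_Nil)
  next
    case (2 l)
    have v': "valid (ereal l) B s" and l: "0 < l" "0 < ereal l" using v d(2) 2(1) by auto
    have "b = lars_move X B s (point B s l) (l - lam)"
      using lars_move_equicorrelated[OF valid_admissible[OF v]] d(5) by simp
    moreover have "lam = active_level X y B b"
      using active_level_point[OF v' l(2) 2(2)] d(5) lam by simp
    moreover have "0 \<le> l - lam" "l - lam \<le> lars_step X y B s (point B s l)"
      using lars_step_point[OF v' l(1) 2(2)] d(3,4) 2(1) by auto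
    ultimately show ?thesis unfolding on_lars_path_def using 2(3) by blast
  qed
qed

end

theorem lemma2:
  fixes X :: "real mat" and y :: "real vec" and n p :: nat
    and tie :: "nat list \<Rightarrow> nat set \<Rightarrow> nat"
  assumes "X \<in> carrier_mat n p"
    and "vec_space.rank n X = p"
    and "y \<in> carrier_vec n"
    and "\<And>A S. S \<noteq> {} \<Longrightarrow> tie A S \<in> S"
  shows "is_lars_path X y tie
           (primal_path X y (dual_path (X *\<^sub>v (pinv X *\<^sub>v y)) (pinv X) tie))"
proof -
  interpret tie_broken_regression X y n p tie
    by unfold_locales (use assms full_column_rank_inj in blast)+
  show ?thesis
    unfolding is_lars_path_def
  proof (intro allI impI)
    fix lam :: real and b assume lam: "0 \<le> lam"
    obtain b' where b': "on_common_path lam b'" using on_common_path_exists[OF lam] by blast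
    have "on_lars_path X y tie lam b \<longleftrightarrow> b = b'"
      using on_lars_path_iff[OF lam] on_common_path_unique b' by blast
    thus "on_lars_path X y tie lam b \<longleftrightarrow>
        b = primal_path X y (dual_path (X *\<^sub>v (pinv X *\<^sub>v y)) (pinv X) tie) lam"
      using primal_path_eq[OF b'] by simp
  qed
qed

end
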